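(* Let $k\ge 3$, let $H$ be a finite connected $k$-NU graph with $n_H$ vertices, let $G$ be a finite graph, and let $p$ be an $H$-precolouring of $G$. Then the graph $\mathrm{Hom}_B(G,H;p)$ has diameter at most $2n_H\min(k-2,\,n_H)$, and if $H$ is bipartite it has diameter at most $n_H\min(2(k-2),\,n_H)$. (That is, any two vertices of $\mathrm{Hom}_B(G,H;p)$ are joined by a path of at most this length.)
   Context: Graphs are undirected, may have loops, and have no multiple edges. A bipartite graph has no loops. A homomorphism is an edge-preserving vertex map. $H^k$ is the $k$-fold categorical product: tuples are adjacent iff they are adjacent in every coordinate. For $k\ge 3$, $H$ is a $k$-NU graph if there is a homomorphism $f:H^k\to H$ such that $f(x_1,\dots,x_k)=x$ whenever at least $k-1$ of the $x_i$ are equal to $x$. $\mathrm{Hom}(G,H)$ is the graph whose vertices are the homomorphisms $G\to H$, with $\phi\sim\psi$ iff $\phi(u)\sim\psi(v)$ for all $u\sim v$ in $G$. An $H$-precolouring $p$ of $G$ is a map from a subset of $V(G)$ to $V(H)$. $\mathrm{Hom}(G,H;p)$ is the subgraph of $\mathrm{Hom}(G,H)$ induced by the homomorphisms extending $p$. If $H$ is not bipartite, $\mathrm{Hom}_B(G,H;p):=\mathrm{Hom}(G,H;p)$. If $H$ is bipartite, fix black/white bipartitions of $H$ and of (the necessarily bipartite) $G$; then $\mathrm{Hom}_B(G,H;p)$ is the subgraph of $\mathrm{Hom}(G,H;p)$ induced by the homomorphisms mapping black vertices to black vertices (and white to white). *)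

theory Defs
  imports "Graph_Theory.Graph_Theory" "HOL-Library.FuncSet"
begin

text \<open>
  A finite graph (undirected, loops allowed, no multiple edges) is a
  \<^locale>\<open>pair_pseudo_graph\<close>: a finite vertex set \<^const>\<open>pverts\<close> with a symmetric set
  \<^const>\<open>parcs\<close> of ordered pairs, a loop at \<open>v\<close> being the pair \<open>(v, v)\<close>.
\<close>

text \<open>
  Vertex maps are extensional functions, so that maps agreeing on the vertex set are equal.
\<close>

definition graph_homs :: "'a pair_pre_digraph \<Rightarrow> 'b pair_pre_digraph \<Rightarrow> ('a \<Rightarrow> 'b) set" where
  "graph_homs G H = {\<phi> \<in> pverts G \<rightarrow>\<^sub>E pverts H. \<forall>(u, v) \<in> parcs G. (\<phi> u, \<phi> v) \<in> parcs H}"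

definition graph_power :: "'a pair_pre_digraph \<Rightarrow> nat \<Rightarrow> (nat \<Rightarrow> 'a) pair_pre_digraph" where
  "graph_power H k = (let T = {..<k} \<rightarrow>\<^sub>E pverts H in
     \<lparr> pverts = T,
       parcs = {(xs, ys) \<in> T \<times> T. \<forall>i<k. (xs i, ys i) \<in> parcs H} \<rparr>)"

definition NU_graph :: "nat \<Rightarrow> 'a pair_pre_digraph \<Rightarrow> bool" where
  "NU_graph k H \<longleftrightarrow> (\<exists>f \<in> graph_homs (graph_power H k) H.
     \<forall>xs \<in> pverts (graph_power H k). \<forall>x \<in> pverts H.
       card {i \<in> {..<k}. xs i = x} \<ge> k - 1 \<longrightarrow> f xs = x)"

definition hom_graph :: "'a pair_pre_digraph \<Rightarrow> 'b pair_pre_digraph \<Rightarrow> ('a \<Rightarrow> 'b) pair_pre_digraph" where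
  "hom_graph G H = \<lparr> pverts = graph_homs G H,
     parcs = {(\<phi>, \<psi>) \<in> graph_homs G H \<times> graph_homs G H.
                \<forall>(u, v) \<in> parcs G. (\<phi> u, \<psi> v) \<in> parcs H} \<rparr>"

definition precolouring :: "'a pair_pre_digraph \<Rightarrow> 'b pair_pre_digraph \<Rightarrow> ('a \<rightharpoonup> 'b) \<Rightarrow> bool" where
  "precolouring G H p \<longleftrightarrow> dom p \<subseteq> pverts G \<and> ran p \<subseteq> pverts H"

definition hom_ext_graph ::
  "'a pair_pre_digraph \<Rightarrow> 'b pair_pre_digraph \<Rightarrow> ('a \<rightharpoonup> 'b) \<Rightarrow> ('a \<Rightarrow> 'b, ('a \<Rightarrow> 'b) \<times> ('a \<Rightarrow> 'b)) pre_digraph"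
where
  "hom_ext_graph G H p =
     with_proj (hom_graph G H) \<restriction> {\<phi> \<in> graph_homs G H. \<forall>v \<in> dom p. p v = Some (\<phi> v)}"

definition bipartition :: "'a pair_pre_digraph \<Rightarrow> 'a set \<Rightarrow> 'a set \<Rightarrow> bool" where
  "bipartition G B W \<longleftrightarrow> B \<union> W = pverts G \<and> B \<inter> W = {} \<and>
     (\<forall>(u, v) \<in> parcs G. u \<in> B \<and> v \<in> W \<or> u \<in> W \<and> v \<in> B)"

definition bipartite :: "'a pair_pre_digraph \<Rightarrow> bool" where
  "bipartite G \<longleftrightarrow> (\<exists>B W. bipartition G B W)"

text \<open>
  The black and white classes \<open>BG\<close>, \<open>WG\<close> of \<open>G\<close> and \<open>BH\<close>, \<open>WH\<close> of \<open>H\<close> are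
  only used if \<open>H\<close> is bipartite.
\<close>

definition homB_graph ::
  "'a pair_pre_digraph \<Rightarrow> 'b pair_pre_digraph \<Rightarrow> ('a \<rightharpoonup> 'b) \<Rightarrow> 'a set \<Rightarrow> 'a set \<Rightarrow> 'b set \<Rightarrow> 'b set \<Rightarrow>
     ('a \<Rightarrow> 'b, ('a \<Rightarrow> 'b) \<times> ('a \<Rightarrow> 'b)) pre_digraph"
where
  "homB_graph G H p BG WG BH WH =
     (if bipartite H
      then hom_ext_graph G H p \<restriction>
             {\<phi> \<in> verts (hom_ext_graph G H p). \<phi> ` BG \<subseteq> BH \<and> \<phi> ` WG \<subseteq> WH}
      else hom_ext_graph G H p)"

text \<open>
  With unit arc weights \<^const>\<open>wf_digraph.\<mu>\<close> is the usual distance, infinite between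
  different components. The diameter of the graph without vertices is \<open>-\<infinity>\<close>.
\<close>

definition diameter :: "('a, 'b) pre_digraph \<Rightarrow> ereal" where
  "diameter G = (SUP u \<in> verts G. SUP v \<in> verts G. wf_digraph.\<mu> G (\<lambda>_. 1) u v)"

lemma wf_induce_subgraph: "wf_digraph (G \<restriction> W)"
  by unfold_locales auto

lemma wf_homB_graph: "wf_digraph (homB_graph G H p BG WG BH WH)"
  by (simp add: homB_graph_def hom_ext_graph_def wf_induce_subgraph)

lemma diameter_le_iff:
  assumes "wf_digraph G"
  shows "diameter G \<le> ereal (real d) \<longleftrightarrow>
    (\<forall>u \<in> verts G. \<forall>v \<in> verts G. \<exists>p. pre_digraph.awalk G u p v \<and> length p \<le> d)"
proof -
  interpret wf_digraph G by (rule assms)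
  have cost: "awalk_cost (\<lambda>_. 1) p = real (length p)" for p
    by (induction p) auto
  have "\<mu> (\<lambda>_. 1) u v \<le> ereal (real d) \<longleftrightarrow> (\<exists>p. awalk u p v \<and> length p \<le> d)" for u v
  proof
    assume "\<mu> (\<lambda>_. 1) u v \<le> ereal (real d)"
    also have "ereal (real d) < ereal (real d + 1)" by simp
    finally obtain p where "awalk u p v" "real (length p) < real d + 1"
      unfolding \<mu>_def cost INF_less_iff by auto
    then show "\<exists>p. awalk u p v \<and> length p \<le> d" by (intro exI[of _ p]) auto
  next
    assume "\<exists>p. awalk u p v \<and> length p \<le> d"
    then show "\<mu> (\<lambda>_. 1) u v \<le> ereal (real d)"
      unfolding \<mu>_def cost by (auto intro: INF_lower2)
  qed
  then show ?thesis
    by (simp add: diameter_def SUP_le_iff)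
qed

end

theory Submission
  imports Defs
begin

text \<open>
  A stiff near unanimity graph has no two distinct vertices \<open>x\<close>, \<open>c\<close> joined by a walk of even length.
  Consider the tree of all walks of length \<open>n\<close> from \<open>x\<close> and pin every leaf to the end of its walk.
  By stiffness the pins propagate upwards and force the colour \<open>x\<close> at the root. However, for large
  \<open>n\<close> any \<open>k - 1\<close> leaves have a long stretch of levels without branchings, along which the colouring
  can be changed so that the root gets colour \<open>c\<close>, and the near unanimity operation combines such
  colourings into one for all leaves.

  Hence \<open>H\<close> can be folded, one vertex at a time, until the vertices reachable from each other by even
  walks coincide. Each fold is one step in the graph of homomorphisms, so two homomorphisms without
  pins are at distance at most \<open>2 * n\<^sub>H\<close>, and moving the coordinates of the near unanimity operation
  one by one gives distance at most \<open>2 * (k - 2) * n\<^sub>H\<close> under a precolouring. Applied to the two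
  projections of the (same-coloured part of the) square of \<open>H\<close>, pinned on the diagonal, this
  connectivity shows that the square folds onto its diagonal. Folding \<open>(x, y)\<close> and \<open>(y, x)\<close>
  simultaneously takes at most \<open>n\<^sub>H\<^sup>2 / 2\<close> steps, and these folds move both homomorphisms of a pair to
  a common one, whence the bound \<open>n\<^sub>H\<^sup>2\<close>.
\<close>

section \<open>Walks of even length\<close>

lemma relpow_invariant:
  assumes "(x, y) \<in> R ^^ n" "I x" "\<And>x y. I x \<Longrightarrow> (x, y) \<in> R \<Longrightarrow> I y"
  shows "I y"
  using assms(1) by (induction n arbitrary: y) (use assms(2,3) in auto)

lemma relpow_map:
  assumes "\<And>x y. (x, y) \<in> R \<Longrightarrow> (h x, h y) \<in> S" "(x, y) \<in> R ^^ n"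
  shows "(h x, h y) \<in> S ^^ n"
  using assms(2) by (induction n arbitrary: y) (auto intro: assms(1))

lemma sym_relpow: "sym R \<Longrightarrow> sym (R ^^ n)"
proof (induction n)
  case (Suc n)
  show ?case
  proof (rule symI)
    fix x y assume "(x, y) \<in> R ^^ Suc n"
    then obtain z where "(x, z) \<in> R ^^ n" "(z, y) \<in> R" by auto
    then have "(z, x) \<in> R ^^ n" "(y, z) \<in> R" using Suc by (auto dest: symD)
    then show "(y, x) \<in> R ^^ Suc n" by (rule relpow_Suc_I2[rotated])
  qed
qed (auto intro: symI)

text \<open>In a connected graph this relates all vertices if there is no bipartition, and otherwise
  the vertices of each colour class. It treats both cases of the definition of Hom_B at
  once.\<close>

definition even_conn :: "('a \<times> 'a) set \<Rightarrow> 'a \<Rightarrow> 'a \<Rightarrow> bool" where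
  "even_conn E x y \<longleftrightarrow> (\<exists>a. (x, y) \<in> E ^^ (2 * a))"

lemma even_connI: "(x, y) \<in> E ^^ n \<Longrightarrow> even n \<Longrightarrow> even_conn E x y"
  unfolding even_conn_def by (elim evenE) auto

lemma even_conn_refl [simp]: "even_conn E x x"
  unfolding even_conn_def by (rule exI[of _ 0]) simp

lemma even_conn_trans: "even_conn E x y \<Longrightarrow> even_conn E y z \<Longrightarrow> even_conn E x z"
proof -
  assume "even_conn E x y" "even_conn E y z"
  then obtain a b where "(x, y) \<in> E ^^ (2 * a)" "(y, z) \<in> E ^^ (2 * b)"
    by (auto simp: even_conn_def)
  then have "(x, z) \<in> E ^^ (2 * (a + b))"
    unfolding distrib_left relpow_add by (rule relcompI)
  then show ?thesis unfolding even_conn_def by blast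
qed

lemma even_conn_sym: "sym E \<Longrightarrow> even_conn E x y \<Longrightarrow> even_conn E y x"
  unfolding even_conn_def by (blast dest: sym_relpow symD)

lemma even_conn_map:
  assumes "\<And>x y. (x, y) \<in> E \<Longrightarrow> (h x, h y) \<in> E'" "even_conn E x y"
  shows "even_conn E' (h x) (h y)"
  using assms(2) relpow_map[of E h E', OF assms(1)] unfolding even_conn_def by blast

lemma even_conn_two_step: "(x, y) \<in> E \<Longrightarrow> (y, z) \<in> E \<Longrightarrow> even_conn E x z"
  unfolding even_conn_def by (rule exI[of _ 1]) (auto simp: numeral_2_eq_2)

section \<open>Trees of walks\<close>

fun walk :: "('a \<times> 'a) set \<Rightarrow> 'a \<Rightarrow> 'a list \<Rightarrow> bool" where
  "walk E x [] \<longleftrightarrow> True"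
| "walk E x (y # w) \<longleftrightarrow> (x, y) \<in> E \<and> walk E y w"

abbreviation walk_end :: "'a \<Rightarrow> 'a list \<Rightarrow> 'a" where
  "walk_end x w \<equiv> last (x # w)"

lemma walk_append: "walk E x (v @ w) \<longleftrightarrow> walk E x v \<and> walk E (walk_end x v) w"
  by (induction v arbitrary: x) auto

lemma walk_relpow: "walk E x w \<Longrightarrow> (x, walk_end x w) \<in> E ^^ length w"
proof (induction w arbitrary: x)
  case (Cons y w)
  then show ?case using relpow_Suc_I2[of x y E "walk_end y w" "length w"] by auto
qed auto

text \<open>
  A walk from \<open>x\<close>, given by its vertices after \<open>x\<close>, is a vertex of the tree of walks from \<open>x\<close>; the
  empty walk is the root. A map \<open>\<Phi>\<close> is a homomorphism on the part of this tree of depth \<open>n\<close>.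
\<close>
definition tree_hom :: "('a \<times> 'a) set \<Rightarrow> nat \<Rightarrow> 'a \<Rightarrow> ('a list \<Rightarrow> 'a) \<Rightarrow> bool" where
  "tree_hom E n x \<Phi> \<longleftrightarrow>
     (\<forall>w y. walk E x (w @ [y]) \<longrightarrow> length w < n \<longrightarrow> (\<Phi> w, \<Phi> (w @ [y])) \<in> E)"

lemma tree_homD:
  "tree_hom E n x \<Phi> \<Longrightarrow> walk E x (w @ [y]) \<Longrightarrow> length w < n \<Longrightarrow> (\<Phi> w, \<Phi> (w @ [y])) \<in> E"
  by (auto simp: tree_hom_def)

text \<open>Above depth \<open>l\<close> colours depend on the depth only and follow
  \<open>g\<close>; below, each subtree has its own colouring. Both agree at depth \<open>l\<close>
  because \<open>\<Psi> v [] = g l\<close>.\<close>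

lemma tree_hom_graft:
  assumes g: "\<And>i. i < l \<Longrightarrow> (g i, g (Suc i)) \<in> E"
    and sub: "\<And>v. walk E x v \<Longrightarrow> length v = l \<Longrightarrow>
      tree_hom E n (walk_end x v) (\<Psi> v) \<and> \<Psi> v [] = g l"
  shows "tree_hom E (l + n) x
    (\<lambda>w. if length w \<le> l then g (length w) else \<Psi> (take l w) (drop l w))"
  unfolding tree_hom_def
proof (intro allI impI)
  fix w y assume w: "walk E x (w @ [y])" "length w < l + n"
  let ?F = "\<lambda>w. if length w \<le> l then g (length w) else \<Psi> (take l w) (drop l w)"
  show "(?F w, ?F (w @ [y])) \<in> E"
  proof (cases "length w < l")
    case True
    then show ?thesis using g by auto
  next
    case False
    let ?v = "take l w"
    have wd: "w @ [y] = ?v @ (drop l w @ [y])" by simp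
    have "walk E x (?v @ (drop l w @ [y]))" using w(1) wd by metis
    then have v: "walk E x ?v" "walk E (walk_end x ?v) (drop l w @ [y])" "length ?v = l"
      using False unfolding walk_append[of _ _ ?v] by auto
    have "(\<Psi> ?v (drop l w), \<Psi> ?v (drop l w @ [y])) \<in> E"
      using sub[OF v(1,3)] v(2) w False by (intro tree_homD) auto
    moreover have "?F w = \<Psi> ?v (drop l w)"
      using False sub[OF v(1,3)] by (cases "length w = l") auto
    moreover have "?F (w @ [y]) = \<Psi> ?v (drop l w @ [y])"
      using False by (auto simp: not_less)
    ultimately show ?thesis by simp
  qed
qed

section \<open>Stiff near unanimity graphs\<close>

text \<open>\<open>F\<close> acts on all sequences, but the axioms look only at the first
  \<open>k\<close> entries. In \<open>F_nu\<close> the exceptional index \<open>j\<close> may be at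
  least \<open>k\<close>, which covers constant tuples.\<close>

locale nu_structure =
  fixes V :: "'b set" and E :: "('b \<times> 'b) set" and k :: nat and F :: "(nat \<Rightarrow> 'b) \<Rightarrow> 'b"
  assumes fin: "finite V" and E_sub: "E \<subseteq> V \<times> V" and symE: "sym E" and k3: "k \<ge> 3"
    and nbr: "x \<in> V \<Longrightarrow> \<exists>y. (x, y) \<in> E"
    and F_edge: "\<And>s t. (\<And>i. i < k \<Longrightarrow> (s i, t i) \<in> E) \<Longrightarrow> (F s, F t) \<in> E"
    and F_nu: "\<And>t x j. (\<And>i. i < k \<Longrightarrow> t i \<in> V) \<Longrightarrow> (\<And>i. i < k \<Longrightarrow> i \<noteq> j \<Longrightarrow> t i = x) \<Longrightarrow> F t = x"
begin

lemma E_in: "(x, y) \<in> E \<Longrightarrow> x \<in> V \<and> y \<in> V"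
  using E_sub by auto

lemma F_closed:
  assumes "\<And>i. i < k \<Longrightarrow> t i \<in> V"
  shows "F t \<in> V"
proof -
  have "\<forall>i\<in>{..<k}. \<exists>y. (t i, y) \<in> E" using nbr assms by auto
  then obtain u where "\<And>i. i < k \<Longrightarrow> (t i, u i) \<in> E"
    by (auto dest!: bchoice)
  then have "(F t, F u) \<in> E" by (rule F_edge)
  then show ?thesis using E_in by blast
qed

text \<open>Walks of equal length are combined vertex by vertex. The length is positive because the
  axioms do not force equal values on sequences that agree in the first \<open>k\<close>
  entries.\<close>

lemma F_relpow:
  assumes "\<And>i. i < k \<Longrightarrow> (s i, t i) \<in> E ^^ Suc n"
  shows "(F s, F t) \<in> E ^^ Suc n"
  using assms
proof (induction n arbitrary: t)
  case 0
  then show ?case using F_edge by simp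
next
  case (Suc n)
  have "\<forall>i\<in>{..<k}. \<exists>y. (s i, y) \<in> E ^^ Suc n \<and> (y, t i) \<in> E"
    using Suc.prems by (blast elim: relpow_Suc_E)
  then obtain u where "\<And>i. i < k \<Longrightarrow> (s i, u i) \<in> E ^^ Suc n" "\<And>i. i < k \<Longrightarrow> (u i, t i) \<in> E"
    by (auto dest!: bchoice)
  then show ?case using Suc.IH F_edge by (blast intro: relpow_Suc_I)
qed

lemma relpow_extend:
  assumes "(x, y) \<in> E ^^ (2 * a)" "y \<in> V" "a \<le> b"
  shows "(x, y) \<in> E ^^ (2 * b)"
  using assms(3)
proof (induction b rule: dec_induct)
  case (step n)
  obtain z where "(y, z) \<in> E" using nbr assms(2) by blast
  moreover from this have "(z, y) \<in> E" using symE by (auto dest: symD)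
  ultimately have "(x, y) \<in> E ^^ Suc (Suc (2 * n))" using step by (meson relpow_Suc_I)
  then show ?case by simp
qed (use assms in simp)

text \<open>Finiteness bounds the lengths of chosen even walks, and shorter ones are padded by going
  back and forth along an edge at the end.\<close>

lemma uniform_even_walk:
  obtains l where "0 < l" "\<And>x y. x \<in> V \<Longrightarrow> y \<in> V \<Longrightarrow> even_conn E x y \<Longrightarrow> (x, y) \<in> E ^^ (2 * l)"
proof -
  define a where "a x y = (SOME a. (x, y) \<in> E ^^ (2 * a))" for x y
  have a: "(x, y) \<in> E ^^ (2 * a x y)" if "even_conn E x y" for x y
    using that unfolding even_conn_def a_def by (rule someI_ex)
  define l where "l = Suc (Max ((\<lambda>(x, y). a x y) ` (V \<times> V)))"
  have "a x y \<le> l" if "x \<in> V" "y \<in> V" for x y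
  proof -
    have "a x y \<in> (\<lambda>(x, y). a x y) ` (V \<times> V)" using that by force
    then show ?thesis unfolding l_def using fin by (intro le_SucI Max_ge) auto
  qed
  then show ?thesis using relpow_extend[OF a] by (intro that[of l]) (simp add: l_def, blast)
qed

lemma walk_end_in: "x \<in> V \<Longrightarrow> walk E x w \<Longrightarrow> walk_end x w \<in> V"
  by (induction w arbitrary: x) (auto dest: E_in)

lemma tree_hom_walk_end: "tree_hom E n x (walk_end x)"
  by (auto simp: tree_hom_def walk_append)

text \<open>
  The key step: few pinned leaves leave the root free. At most \<open>m\<close> leaves branch at most \<open>m - 1\<close>
  times, so one of \<open>m\<close> consecutive blocks of length \<open>2 * l\<close> is free of branchings and can absorb
  the change from the colours above to the colours below.
\<close>
lemma few_leaves_tree_hom: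
  assumes l: "\<And>x y. x \<in> V \<Longrightarrow> y \<in> V \<Longrightarrow> even_conn E x y \<Longrightarrow> (x, y) \<in> E ^^ (2 * l)"
    and "x \<in> V" "c \<in> V" "even_conn E x c"
    and "A \<subseteq> {w. walk E x w \<and> length w = m * (2 * l)}" "finite A" "card A \<le> m"
  shows "\<exists>\<Phi>. tree_hom E (m * (2 * l)) x \<Phi> \<and> \<Phi> [] = c \<and> (\<forall>w\<in>A. \<Phi> w = walk_end x w)"
  using assms(2-)
proof (induction m arbitrary: x c A)
  case 0
  then have "A = {}" by auto
  then show ?case by (intro exI[of _ "\<lambda>_. c"]) (auto simp: tree_hom_def)
next
  case (Suc m)
  define B where "B v = {w. v @ w \<in> A}" for v
  have Bcard: "card (B v) = card ((@) v ` B v)" for v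
    by (intro card_image[symmetric]) (auto intro: inj_onI)
  have Bim: "(@) v ` B v \<subseteq> A" for v by (auto simp: B_def)
  have Bfin: "finite (B v)" for v
    using finite_imageD[of "(@) v" "B v"] finite_subset[OF Bim] Suc.prems by (auto intro: inj_onI)
  have Bsub: "B v \<subseteq> {w. walk E (walk_end x v) w \<and> length w = m * (2 * l)}"
    if "length v = 2 * l" for v
    using Suc.prems(4) that by (auto simp: B_def walk_append)
  have Aw: "take (2 * l) w @ drop (2 * l) w = w" "length (take (2 * l) w) = 2 * l"
    "walk E x (take (2 * l) w)" if "w \<in> A" for w
    using Suc.prems(4) that walk_append[of E x "take (2 * l) w" "drop (2 * l) w"] by auto
  have IH: "\<exists>\<Psi>. tree_hom E (m * (2 * l)) (walk_end x v) \<Psi> \<and> \<Psi> [] = d \<and>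
      (\<forall>w\<in>B v. \<Psi> w = walk_end (walk_end x v) w)"
    if v: "walk E x v" "length v = 2 * l" and d: "(c, d) \<in> E ^^ (2 * l)" "d \<in> V"
      and "card (B v) \<le> m" for v d
  proof (rule Suc.IH)
    have "(x, walk_end x v) \<in> E ^^ (2 * l)" using walk_relpow[OF v(1)] v(2) by simp
    then show "even_conn E (walk_end x v) d"
      using Suc.prems(3) d symE by (meson even_conn_def even_conn_sym even_conn_trans)
    show "walk_end x v \<in> V" using walk_end_in[OF Suc.prems(1)] v(1) .
  qed (use that Bfin Bsub in auto)
  \<comment> \<open>The upper block of \<open>2 * l\<close> levels leads from the root colour
    \<open>c\<close> to \<open>d\<close>. If all pinned leaves lie below one vertex \<open>v\<close>
    at depth \<open>2 * l\<close>, then \<open>d\<close> is the end of \<open>v\<close> and the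
    subtree at \<open>v\<close> is coloured by walk ends. Otherwise \<open>d = c\<close>, and every
    subtree misses a pinned leaf, so the induction hypothesis applies to it.\<close>
  obtain d where d: "(c, d) \<in> E ^^ (2 * l)" "d \<in> V" and \<Psi>: "\<And>v. walk E x v \<Longrightarrow> length v = 2 * l \<Longrightarrow>
      \<exists>\<Psi>. tree_hom E (m * (2 * l)) (walk_end x v) \<Psi> \<and> \<Psi> [] = d \<and>
        (\<forall>w\<in>B v. \<Psi> w = walk_end (walk_end x v) w)"
  proof (cases "\<exists>v. walk E x v \<and> length v = 2 * l \<and> (\<forall>w\<in>A. take (2 * l) w = v)")
    case True
    then obtain v where v: "walk E x v" "length v = 2 * l" "\<forall>w\<in>A. take (2 * l) w = v" by blast
    have "(x, walk_end x v) \<in> E ^^ (2 * l)" using walk_relpow[OF v(1)] v(2) by simp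
    then have "even_conn E c (walk_end x v)"
      using Suc.prems(3) symE by (meson even_conn_def even_conn_sym even_conn_trans)
    then have d: "(c, walk_end x v) \<in> E ^^ (2 * l)" "walk_end x v \<in> V"
      using l Suc.prems walk_end_in v(1) by blast+
    show ?thesis
    proof (rule that[OF d])
      fix u assume u: "walk E x u" "length u = 2 * l"
      show "\<exists>\<Psi>. tree_hom E (m * (2 * l)) (walk_end x u) \<Psi> \<and> \<Psi> [] = walk_end x v \<and>
        (\<forall>w\<in>B u. \<Psi> w = walk_end (walk_end x u) w)"
      proof (cases "u = v")
        case True
        then show ?thesis using tree_hom_walk_end by (intro exI[of _ "walk_end (walk_end x u)"]) auto
      next
        case False
        then have "B u = {}" using v(3) u by (auto simp: B_def)
        then show ?thesis using IH[OF u d] by simp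
      qed
    qed
  next
    case False
    have d: "(c, c) \<in> E ^^ (2 * l)" "c \<in> V" using l Suc.prems by auto
    show ?thesis
    proof (rule that[OF d])
      fix u assume u: "walk E x u" "length u = 2 * l"
      then obtain w where w: "w \<in> A" "take (2 * l) w \<noteq> u" using False by blast
      then have "(@) u ` B u \<subseteq> A - {w}" using Bim u by auto
      then have "card (B u) \<le> card (A - {w})"
        unfolding Bcard using Suc.prems(5) by (intro card_mono) auto
      then have "card (B u) \<le> m" using Suc.prems(5,6) w(1) by (simp add: card_Diff_singleton)
      then show "\<exists>\<Psi>. tree_hom E (m * (2 * l)) (walk_end x u) \<Psi> \<and> \<Psi> [] = c \<and>
        (\<forall>w\<in>B u. \<Psi> w = walk_end (walk_end x u) w)"
        using IH[OF u d] by simp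
    qed
  qed
  obtain g where g: "g 0 = c" "g (2 * l) = d" "\<And>i. i < 2 * l \<Longrightarrow> (g i, g (Suc i)) \<in> E"
    using d(1) unfolding relpow_fun_conv by auto
  obtain \<Psi> where \<Psi>: "\<And>v. walk E x v \<Longrightarrow> length v = 2 * l \<Longrightarrow>
      tree_hom E (m * (2 * l)) (walk_end x v) (\<Psi> v) \<and> \<Psi> v [] = g (2 * l) \<and>
        (\<forall>w\<in>B v. \<Psi> v w = walk_end (walk_end x v) w)"
    using \<Psi> unfolding g(2) by metis
  let ?F = "\<lambda>w. if length w \<le> 2 * l then g (length w) else \<Psi> (take (2 * l) w) (drop (2 * l) w)"
  have "tree_hom E (2 * l + m * (2 * l)) x ?F"
    using g(3) \<Psi> by (intro tree_hom_graft) auto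
  moreover have "?F w = walk_end x w" if "w \<in> A" for w
  proof -
    let ?v = "take (2 * l) w" and ?u = "drop (2 * l) w"
    have "?u \<in> B ?v" using Aw(1) that by (simp add: B_def)
    then have "\<Psi> ?v ?u = walk_end (walk_end x ?v) ?u" using \<Psi> Aw that by blast
    also have "\<dots> = walk_end x (?v @ ?u)" by simp
    finally have "\<Psi> ?v ?u = walk_end x w" by simp
    moreover have "?F w = \<Psi> ?v ?u"
      using \<Psi>[OF Aw(3,2)[OF that]] Aw(2)[OF that] by (cases "length w = 2 * l") auto
    ultimately show ?thesis by simp
  qed
  ultimately show ?case using g(1) by (intro exI[of _ ?F]) auto
qed

text \<open>Given \<open>k\<close> pinned leaves \<open>e i\<close>, colourings
  \<open>\<Phi> i\<close> that may fail on \<open>A\<close> only at \<open>e i\<close> are combined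
  by \<open>F\<close>: each leaf of \<open>A\<close> is wrong in at most one of them.\<close>

lemma all_leaves_tree_hom:
  assumes few: "\<And>A. A \<subseteq> L \<Longrightarrow> card A \<le> k - 1 \<Longrightarrow>
      \<exists>\<Phi>. tree_hom E n x \<Phi> \<and> \<Phi> [] = c \<and> (\<forall>w\<in>A. \<Phi> w = walk_end x w)"
    and L: "finite L" "\<And>w. w \<in> L \<Longrightarrow> walk E x w \<and> length w = n \<and> 0 < n"
    and "x \<in> V" "c \<in> V"
  shows "A \<subseteq> L \<Longrightarrow> \<exists>\<Phi>. tree_hom E n x \<Phi> \<and> \<Phi> [] = c \<and> (\<forall>w\<in>A. \<Phi> w = walk_end x w)"
proof (induction "card A" arbitrary: A rule: less_induct)
  case less
  show ?case
  proof (cases "card A \<le> k - 1")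
    case True
    then show ?thesis using few less.prems by blast
  next
    case False
    have finA: "finite A" using less.prems L(1) finite_subset by blast
    obtain e where e: "inj_on e {..<k}" "e ` {..<k} \<subseteq> A"
    proof -
      have "card {..<k} \<le> card A" using False k3 by simp
      then show ?thesis using card_le_inj[of "{..<k}" A] finA that by blast
    qed
    have "\<exists>\<Phi>. tree_hom E n x \<Phi> \<and> \<Phi> [] = c \<and> (\<forall>w\<in>A - {e i}. \<Phi> w = walk_end x w)"
      if "i < k" for i
    proof (rule less.hyps)
      have "e i \<in> A" using e(2) that by auto
      then show "card (A - {e i}) < card A" using finA by (intro psubset_card_mono) auto
    qed (use less.prems in auto)
    then have "\<forall>i\<in>{..<k}. \<exists>\<Phi>. tree_hom E n x \<Phi> \<and> \<Phi> [] = c \<and> (\<forall>w\<in>A - {e i}. \<Phi> w = walk_end x w)"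
      by blast
    then obtain \<Phi> where "\<forall>i\<in>{..<k}. tree_hom E n x (\<Phi> i) \<and> \<Phi> i [] = c \<and>
        (\<forall>w\<in>A - {e i}. \<Phi> i w = walk_end x w)"
      by (rule bchoice[THEN exE])
    then have \<Phi>: "\<And>i. i < k \<Longrightarrow> tree_hom E n x (\<Phi> i)" "\<And>i. i < k \<Longrightarrow> \<Phi> i [] = c"
        "\<And>i w. i < k \<Longrightarrow> w \<in> A \<Longrightarrow> w \<noteq> e i \<Longrightarrow> \<Phi> i w = walk_end x w"
      by blast+
    let ?\<Psi> = "\<lambda>w. F (\<lambda>i. \<Phi> i w)"
    have "tree_hom E n x ?\<Psi>"
      unfolding tree_hom_def using tree_homD[OF \<Phi>(1)] by (blast intro: F_edge)
    moreover have "?\<Psi> [] = c"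
      using \<Phi>(2) assms(5) by (intro F_nu[of _ k]) auto
    moreover have "?\<Psi> w = walk_end x w" if "w \<in> A" for w
    proof -
      have w: "walk E x w" "length w = n" "0 < n" using that less.prems L(2) by auto
      have wn: "w = butlast w @ [last w]" using w by (cases w rule: rev_cases) auto
      \<comment> \<open>Even where \<open>\<Phi> i\<close> is not pinned, the colour of a leaf is a
        vertex, being the end of an edge as \<open>0 < n\<close>.\<close>
      have V: "\<Phi> i w \<in> V" if "i < k" for i
        using tree_homD[OF \<Phi>(1)[OF that], of "butlast w" "last w"] w wn E_in by auto
      show ?thesis
      proof (cases "\<exists>j<k. e j = w")
        case True
        then obtain j where j: "j < k" "e j = w" by blast
        then have "w \<noteq> e i" if "i < k" "i \<noteq> j" for i
          using e(1) that by (auto simp: inj_on_def)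
        then show ?thesis using V \<Phi>(3)[OF _ that] by (intro F_nu[of _ j]) auto
      next
        case False
        then show ?thesis using V \<Phi>(3)[OF _ that] by (intro F_nu[of _ k]) auto
      qed
    qed
    ultimately show ?thesis by blast
  qed
qed

text \<open>Induction from the leaves upwards: if all children of \<open>w\<close> have the intended
  colours, the colour of \<open>w\<close> is adjacent to every neighbour of the end of
  \<open>w\<close>, and by stiffness it is this end.\<close>

lemma stiff_pinned_leaves:
  assumes stiff: "\<And>a b. a \<in> V \<Longrightarrow> b \<in> V \<Longrightarrow> E `` {a} \<subseteq> E `` {b} \<Longrightarrow> a = b"
    and "x \<in> V" and \<Phi>: "tree_hom E n x \<Phi>"
    and leaves: "\<And>w. walk E x w \<Longrightarrow> length w = n \<Longrightarrow> \<Phi> w = walk_end x w"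
  shows "walk E x w \<Longrightarrow> length w \<le> n \<Longrightarrow> \<Phi> w = walk_end x w"
proof (induction "n - length w" arbitrary: w)
  case 0
  then show ?case using leaves by auto
next
  case (Suc j)
  let ?e = "walk_end x w"
  have e: "?e \<in> V" using walk_end_in \<open>x \<in> V\<close> Suc.prems by blast
  have *: "(\<Phi> w, y) \<in> E" if "(?e, y) \<in> E" for y
  proof -
    have w: "walk E x (w @ [y])" using Suc.prems that by (simp add: walk_append)
    then have "\<Phi> (w @ [y]) = y" using Suc by auto
    then show ?thesis using tree_homD[OF \<Phi> w] Suc by auto
  qed
  moreover obtain y where "(?e, y) \<in> E" using nbr e by blast
  ultimately have "\<Phi> w \<in> V" using E_in by blast
  then have "?e = \<Phi> w" using * e by (intro stiff) auto
  then show ?case by simp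
qed

theorem ex_fold:
  assumes "x \<in> V" "c \<in> V" "x \<noteq> c" "even_conn E x c"
  shows "\<exists>a\<in>V. \<exists>b\<in>V. a \<noteq> b \<and> E `` {a} \<subseteq> E `` {b}"
proof (rule ccontr)
  assume "\<not> ?thesis"
  then have stiff: "\<And>a b. a \<in> V \<Longrightarrow> b \<in> V \<Longrightarrow> E `` {a} \<subseteq> E `` {b} \<Longrightarrow> a = b" by blast
  obtain l where "0 < l" and l: "\<And>x y. x \<in> V \<Longrightarrow> y \<in> V \<Longrightarrow> even_conn E x y \<Longrightarrow> (x, y) \<in> E ^^ (2 * l)"
    using uniform_even_walk by blast
  \<comment> \<open>The \<open>k - 1\<close> blocks of \<open>2 * l\<close> levels suffice for
    \<open>k - 1\<close> pinned leaves; near unanimity then extends this to all leaves.\<close>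
  define n where "n = (k - 1) * (2 * l)"
  define L where "L = {w. walk E x w \<and> length w = n}"
  have "0 < n" using \<open>0 < l\<close> k3 by (simp add: n_def)
  have "set w \<subseteq> V" if "walk E y w" for y w
    using that by (induction w arbitrary: y) (auto dest: E_in)
  then have "L \<subseteq> {w. set w \<subseteq> V \<and> length w = n}" by (auto simp: L_def)
  then have "finite L" using finite_lists_length_eq[OF fin] finite_subset by blast
  have "\<exists>\<Phi>. tree_hom E n x \<Phi> \<and> \<Phi> [] = c \<and> (\<forall>w\<in>L. \<Phi> w = walk_end x w)"
  proof (rule all_leaves_tree_hom[of L])
    fix A assume "A \<subseteq> L" "card A \<le> k - 1"
    then show "\<exists>\<Phi>. tree_hom E n x \<Phi> \<and> \<Phi> [] = c \<and> (\<forall>w\<in>A. \<Phi> w = walk_end x w)"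
      using assms \<open>finite L\<close> finite_subset unfolding n_def L_def
      by (intro few_leaves_tree_hom[OF l]) auto
  qed (use \<open>finite L\<close> \<open>0 < n\<close> assms in \<open>auto simp: L_def\<close>)
  then obtain \<Phi> where \<Phi>: "tree_hom E n x \<Phi>" "\<Phi> [] = c" "\<And>w. w \<in> L \<Longrightarrow> \<Phi> w = walk_end x w" by blast
  have leaves: "\<Phi> w = walk_end x w" if "walk E x w" "length w = n" for w
    using that by (intro \<Phi>(3)) (simp add: L_def)
  have "\<Phi> [] = walk_end x []"
    by (rule stiff_pinned_leaves; (rule stiff \<open>x \<in> V\<close> \<Phi>(1) leaves)?) simp_all
  then show False using \<Phi>(2) assms(3) by simp
qed

end

section \<open>Folds and walks of homomorphisms\<close>

text \<open>Lists encode the pins and the restriction to colour classes in a single condition at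
  each vertex.\<close>

definition list_homs ::
  "'a pair_pre_digraph \<Rightarrow> 'b pair_pre_digraph \<Rightarrow> ('a \<Rightarrow> 'b set) \<Rightarrow> ('a \<Rightarrow> 'b) set" where
  "list_homs G H C = {\<phi> \<in> graph_homs G H. \<forall>u\<in>pverts G. \<phi> u \<in> C u}"

definition hom_step ::
  "'a pair_pre_digraph \<Rightarrow> 'b pair_pre_digraph \<Rightarrow> ('a \<Rightarrow> 'b set) \<Rightarrow> (('a \<Rightarrow> 'b) \<times> ('a \<Rightarrow> 'b)) set" where
  "hom_step G H C = {(\<phi>, \<psi>) \<in> list_homs G H C \<times> list_homs G H C.
     \<forall>(u, v)\<in>parcs G. (\<phi> u, \<psi> v) \<in> parcs H}"

lemma list_homsI:
  assumes "\<phi> \<in> extensional (pverts G)" "\<And>u. u \<in> pverts G \<Longrightarrow> \<phi> u \<in> pverts H"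
    "\<And>u v. (u, v) \<in> parcs G \<Longrightarrow> (\<phi> u, \<phi> v) \<in> parcs H" "\<And>u. u \<in> pverts G \<Longrightarrow> \<phi> u \<in> C u"
  shows "\<phi> \<in> list_homs G H C"
  using assms by (auto simp: list_homs_def graph_homs_def PiE_def)

lemma list_homsD:
  assumes "\<phi> \<in> list_homs G H C"
  shows "\<phi> \<in> extensional (pverts G)" "\<And>u. u \<in> pverts G \<Longrightarrow> \<phi> u \<in> pverts H"
    "\<And>u v. (u, v) \<in> parcs G \<Longrightarrow> (\<phi> u, \<phi> v) \<in> parcs H" "\<And>u. u \<in> pverts G \<Longrightarrow> \<phi> u \<in> C u"
  using assms by (auto simp: list_homs_def graph_homs_def PiE_def)

lemma hom_stepI:
  assumes "\<phi> \<in> list_homs G H C" "\<psi> \<in> list_homs G H C"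
    "\<And>u v. (u, v) \<in> parcs G \<Longrightarrow> (\<phi> u, \<psi> v) \<in> parcs H"
  shows "(\<phi>, \<psi>) \<in> hom_step G H C"
  using assms by (auto simp: hom_step_def)

lemma hom_stepD:
  assumes "(\<phi>, \<psi>) \<in> hom_step G H C"
  shows "\<phi> \<in> list_homs G H C" "\<psi> \<in> list_homs G H C"
    "\<And>u v. (u, v) \<in> parcs G \<Longrightarrow> (\<phi> u, \<psi> v) \<in> parcs H"
  using assms by (auto simp: hom_step_def)

lemma sym_hom_step: "sym (parcs G) \<Longrightarrow> sym (parcs H) \<Longrightarrow> sym (hom_step G H C)"
  by (rule symI) (auto intro!: hom_stepI dest: hom_stepD symD)

text \<open>Composing with fixed homomorphisms on both sides preserves steps, so a walk of
  endomorphisms found once for \<open>K\<close> serves every \<open>G\<close>. \<open>K\<close> will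
  be \<open>H\<close>, with \<open>h\<close> the identity, or the square of \<open>H\<close>, with
  \<open>h\<close> a projection.\<close>

lemma hom_step_map:
  assumes G: "parcs G \<subseteq> pverts G \<times> pverts G" and \<chi>: "\<chi> \<in> graph_homs G K"
    and h: "\<And>x. x \<in> pverts K \<Longrightarrow> h x \<in> pverts H" "\<And>x y. (x, y) \<in> parcs K \<Longrightarrow> (h x, h y) \<in> parcs H"
    and D: "\<And>u a. u \<in> pverts G \<Longrightarrow> a \<in> pverts K \<Longrightarrow> a \<in> C (\<chi> u) \<Longrightarrow> h a \<in> D u"
    and t: "(t, t') \<in> hom_step K K C ^^ m"
  shows "(\<lambda>u\<in>pverts G. h (t (\<chi> u)), \<lambda>u\<in>pverts G. h (t' (\<chi> u))) \<in> hom_step G H D ^^ m"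
proof (rule relpow_map[where h = "\<lambda>t. \<lambda>u\<in>pverts G. h (t (\<chi> u))", OF _ t])
  fix t t' assume t: "(t, t') \<in> hom_step K K C"
  have \<chi>: "\<And>u. u \<in> pverts G \<Longrightarrow> \<chi> u \<in> pverts K" "\<And>u v. (u, v) \<in> parcs G \<Longrightarrow> (\<chi> u, \<chi> v) \<in> parcs K"
    using \<chi> by (auto simp: graph_homs_def)
  have in_G: "u \<in> pverts G" "v \<in> pverts G" if "(u, v) \<in> parcs G" for u v
    using that G by auto
  have *: "(\<lambda>u\<in>pverts G. h (s (\<chi> u))) \<in> list_homs G H D" if "s \<in> list_homs K K C" for s
    using that by (intro list_homsI) (auto simp: in_G intro!: h D \<chi> dest: list_homsD)
  show "(\<lambda>u\<in>pverts G. h (t (\<chi> u)), \<lambda>u\<in>pverts G. h (t' (\<chi> u))) \<in> hom_step G H D"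
    by (intro hom_stepI * hom_stepD[OF t]) (auto simp: in_G intro!: h \<chi> hom_stepD(3)[OF t])
qed

text \<open>\<open>t\<close> is a retraction onto \<open>S\<close> reached from the identity by a
  walk of length \<open>m\<close>. Steps are counted instead of removed vertices because one step
  may fold several vertices.\<close>

definition folds ::
  "'a pair_pre_digraph \<Rightarrow> ('a \<Rightarrow> 'a set) \<Rightarrow> nat \<Rightarrow> 'a set \<Rightarrow> ('a \<Rightarrow> 'a) \<Rightarrow> bool" where
  "folds K C m S t \<longleftrightarrow> t \<in> list_homs K K C \<and> (restrict id (pverts K), t) \<in> hom_step K K C ^^ m \<and>
     S \<subseteq> pverts K \<and> (\<forall>x\<in>pverts K. t x \<in> S) \<and> (\<forall>x\<in>S. t x = x)"

lemma foldsD: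
  assumes "folds K C m S t"
  shows "t \<in> list_homs K K C" "(restrict id (pverts K), t) \<in> hom_step K K C ^^ m"
    "\<And>x. x \<in> S \<Longrightarrow> x \<in> pverts K" "\<And>x. x \<in> pverts K \<Longrightarrow> t x \<in> S" "\<And>x. x \<in> S \<Longrightarrow> t x = x"
  using assms by (auto simp: folds_def)

lemma folds_0:
  assumes "parcs K \<subseteq> pverts K \<times> pverts K" "\<And>x. x \<in> pverts K \<Longrightarrow> x \<in> C x"
  shows "folds K C 0 (pverts K) (restrict id (pverts K))"
  using assms by (auto simp: folds_def intro!: list_homsI)

text \<open>As \<open>s\<close> moves each vertex of \<open>S\<close> to one adjacent to all its
  neighbours in \<open>S\<close>, the maps \<open>t\<close> and \<open>s \<circ> t\<close> are
  adjacent. Moving the other end of the edge too shows that \<open>s \<circ> t\<close> is a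
  homomorphism.\<close>

lemma folds_Suc:
  assumes t: "folds K C m S t" and K: "parcs K \<subseteq> pverts K \<times> pverts K" "sym (parcs K)"
    and S': "S' \<subseteq> S" "\<And>x. x \<in> S' \<Longrightarrow> s x = x"
    and s: "\<And>x. x \<in> S \<Longrightarrow> s x \<in> S'"
      "\<And>x y. x \<in> S \<Longrightarrow> y \<in> S \<Longrightarrow> (x, y) \<in> parcs K \<Longrightarrow> (s x, y) \<in> parcs K"
    and C: "\<And>x. x \<in> pverts K \<Longrightarrow> s (t x) \<in> C x"
  shows "folds K C (Suc m) S' (\<lambda>x\<in>pverts K. s (t x))" (is "folds _ _ _ _ ?t")
proof -
  note t = foldsD[OF t]
  have in_K: "u \<in> pverts K" "v \<in> pverts K" if "(u, v) \<in> parcs K" for u v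
    using that K by auto
  have *: "(t u, s (t v)) \<in> parcs K" if "(u, v) \<in> parcs K" for u v
    using that s(2)[of "t v" "t u"] t in_K[OF that] list_homsD(3)[OF t(1) that] K(2)
    by (auto dest: symD)
  have **: "(s (t u), s (t v)) \<in> parcs K" if "(u, v) \<in> parcs K" for u v
    using s(2)[OF _ _ *[OF that]] s(1) S'(1) t(4) in_K[OF that] by blast
  have "s (t x) \<in> pverts K" if "x \<in> pverts K" for x
    using that t S'(1) s(1) by blast
  then have t': "?t \<in> list_homs K K C"
    using ** C by (intro list_homsI) (auto simp: in_K)
  moreover have "(t, ?t) \<in> hom_step K K C"
    using * by (intro hom_stepI t(1) t') (auto simp: in_K)
  then have "(restrict id (pverts K), ?t) \<in> hom_step K K C ^^ Suc m"
    using t(2) by (rule relpow_Suc_I[rotated])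
  ultimately show ?thesis
    using S' s t by (auto simp: folds_def subset_iff)
qed

text \<open>For connected \<open>H\<close>, \<open>P = dom p\<close> and a vertex
  \<open>\<phi>\<close> of Hom_B, these lists cut out exactly Hom_B.\<close>

definition pin_lists :: "('b \<times> 'b) set \<Rightarrow> 'a set \<Rightarrow> ('a \<Rightarrow> 'b) \<Rightarrow> 'a \<Rightarrow> 'b set" where
  "pin_lists E P \<phi> u = {y. even_conn E y (\<phi> u) \<and> (u \<in> P \<longrightarrow> y = \<phi> u)}"

section \<open>The core of a near unanimity graph, and walks without and with pins\<close>

context nu_structure
begin

abbreviation H where "H \<equiv> \<lparr>pverts = V, parcs = E\<rparr>"

text \<open>Walks of one common even length from all entries to \<open>x\<close> are combined by
  \<open>F\<close>, which takes the value \<open>x\<close> on the constant tuple.\<close>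

lemma F_even_conn:
  assumes "\<And>i. i < k \<Longrightarrow> s i \<in> V" "\<And>i. i < k \<Longrightarrow> even_conn E (s i) x" "x \<in> V"
  shows "even_conn E (F s) x"
proof -
  obtain l where l: "0 < l" "\<And>x y. x \<in> V \<Longrightarrow> y \<in> V \<Longrightarrow> even_conn E x y \<Longrightarrow> (x, y) \<in> E ^^ (2 * l)"
    using uniform_even_walk by blast
  have "(F s, F (\<lambda>_. x)) \<in> E ^^ Suc (2 * l - 1)"
    using l assms by (intro F_relpow) auto
  moreover have "F (\<lambda>_. x) = x" using assms(3) by (intro F_nu) auto
  ultimately show ?thesis using l(1) unfolding even_conn_def by (intro exI[of _ l]) simp
qed

text \<open>The retraction \<open>t\<close> follows the operation and fixes its values in
  \<open>S\<close>. This makes \<open>ex_fold\<close> available for retracts.\<close>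

lemma nu_structure_retract:
  assumes "folds H C m S t"
  shows "nu_structure S (E \<inter> S \<times> S) k (\<lambda>u. t (F u))"
proof (rule nu_structure.intro)
  note t = foldsD[OF assms, simplified]
  note th = list_homsD[OF t(1), simplified]
  show "finite S" using t(3) by (intro finite_subset[OF _ fin]) auto
  show "sym (E \<inter> S \<times> S)" using symE by (auto intro!: symI dest: symD)
  show "\<exists>y. (x, y) \<in> E \<inter> S \<times> S" if x: "x \<in> S" for x
  proof -
    obtain y where y: "(x, y) \<in> E" using nbr t(3) x by blast
    then show ?thesis using th(3)[OF y] t(4)[of y] t(5)[OF x] x E_in by auto
  qed
  show "(t (F u), t (F v)) \<in> E \<inter> S \<times> S" if "\<And>i. i < k \<Longrightarrow> (u i, v i) \<in> E \<inter> S \<times> S" for u v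
  proof -
    have "(F u, F v) \<in> E" using that by (intro F_edge) auto
    then show ?thesis using th(3) t(4) E_in by auto
  qed
  show "t (F u) = x" if u: "\<And>i. i < k \<Longrightarrow> u i \<in> S" "\<And>i. i < k \<Longrightarrow> i \<noteq> j \<Longrightarrow> u i = x" for u x j
  proof -
    obtain i where "i < k" "i \<noteq> j" using k3 by (cases "j = 0") (auto intro: that[of 0] that[of 1])
    then have "x \<in> S" using u(1)[of i] u(2)[of i] by simp
    moreover have "F u = x" using u t(3) by (intro F_nu) auto
    ultimately show ?thesis using t(5) by simp
  qed
qed (use k3 in auto)

text \<open>In a retract of minimal size, two distinct vertices joined by an even walk would yield a
  further fold by \<open>ex_fold\<close>. Each fold removes one vertex, so \<open>m + card S\<close>
  stays constant, which bounds \<open>m\<close>.\<close>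

lemma ex_core:
  obtains m S t where "folds H (pin_lists E {} id) m S t" "m \<le> card V"
    "\<And>x y. x \<in> S \<Longrightarrow> y \<in> S \<Longrightarrow> even_conn E x y \<Longrightarrow> x = y"
proof -
  let ?C = "pin_lists E {} id"
  let ?P = "\<lambda>(m, S, t). folds H ?C m S t \<and> m + card S = card V"
  have "?P (0, V, restrict id V)"
    using folds_0[of H ?C] E_sub by (auto simp: pin_lists_def)
  then obtain M where M: "?P M" "\<And>M'. ?P M' \<Longrightarrow> card (fst (snd M)) \<le> card (fst (snd M'))"
    using ex_has_least_nat[of ?P _ "\<lambda>M. card (fst (snd M))"] by blast
  obtain m S t where mst: "M = (m, S, t)" by (cases M) auto
  have f: "folds H ?C m S t" and card: "m + card S = card V" using M(1) mst by auto
  note t = foldsD[OF f, simplified]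
  note th = list_homsD[OF t(1), simplified]
  interpret R: nu_structure S "E \<inter> S \<times> S" k "\<lambda>u. t (F u)"
    by (rule nu_structure_retract[OF f])
  have "x = y" if x: "x \<in> S" and y: "y \<in> S" and e: "even_conn E x y" for x y
  proof (rule ccontr)
    assume "x \<noteq> y"
    \<comment> \<open>The even walk may leave \<open>S\<close>; \<open>t\<close> brings it back and
      fixes its ends.\<close>
    have "even_conn (E \<inter> S \<times> S) (t x) (t y)"
      using e by (rule even_conn_map[rotated]) (use th(3) t(4) E_in in auto)
    then have "even_conn (E \<inter> S \<times> S) x y" using t(5) x y by simp
    then obtain a b where ab: "a \<in> S" "b \<in> S" "a \<noteq> b"
        "(E \<inter> S \<times> S) `` {a} \<subseteq> (E \<inter> S \<times> S) `` {b}"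
      using R.ex_fold[OF x y \<open>x \<noteq> y\<close>] by blast
    \<comment> \<open>A common neighbour joins \<open>a\<close> and \<open>b\<close> by two edges,
      so the fold respects the lists.\<close>
    obtain c where "(a, c) \<in> E \<inter> S \<times> S" using R.nbr ab(1) by blast
    then have "even_conn E b a" using ab(4) symE by (auto intro!: even_conn_two_step[of b c] dest: symD)
    let ?s = "\<lambda>z. if z = a then b else z"
    have "folds H ?C (Suc m) (S - {a}) (\<lambda>x\<in>pverts H. ?s (t x))"
    proof (rule folds_Suc[OF f])
      show "?s (t x) \<in> ?C x" if "x \<in> pverts H" for x
        using th(4)[of x] that \<open>even_conn E b a\<close> by (auto simp: pin_lists_def intro: even_conn_trans)
      show "(?s x, y) \<in> parcs H" if "x \<in> S" "y \<in> S" "(x, y) \<in> parcs H" for x y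
        using ab(4) that by auto
    qed (use ab E_sub symE in auto)
    moreover have "card S \<noteq> 0" using ab(1) R.fin by auto
    then have "Suc m + card (S - {a}) = card V" using ab(1) card by (simp add: card_Diff_singleton)
    ultimately have "?P (Suc m, S - {a}, \<lambda>x\<in>V. ?s (t x))" by simp
    from M(2)[OF this] show False
      using card_Diff1_less[OF R.fin ab(1)] mst by simp
  qed
  then show ?thesis using that f card by (metis le_add1)
qed

text \<open>Folding \<open>H\<close> onto its core takes both homomorphisms to the same map, in
  \<open>m\<close> steps each: their values remain joined by even walks, and in the core such
  vertices coincide.\<close>

lemma unpinned_walk:
  assumes G: "parcs G \<subseteq> pverts G \<times> pverts G" "sym (parcs G)"
    and \<phi>: "\<phi> \<in> list_homs G H (pin_lists E {} \<phi>)" and \<psi>: "\<psi> \<in> list_homs G H (pin_lists E {} \<phi>)"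
  obtains m where "m \<le> card V" "(\<phi>, \<psi>) \<in> hom_step G H (pin_lists E {} \<phi>) ^^ (2 * m)"
proof -
  let ?D = "pin_lists E {} \<phi>"
  obtain m S t where f: "folds H (pin_lists E {} id) m S t" and m: "m \<le> card V"
    and S: "\<And>x y. x \<in> S \<Longrightarrow> y \<in> S \<Longrightarrow> even_conn E x y \<Longrightarrow> x = y"
    using ex_core by blast
  note t = foldsD[OF f, simplified]
  note th = list_homsD[OF t(1), simplified]
  define T where "T \<chi> = (\<lambda>u\<in>pverts G. t (\<chi> u))" for \<chi>
  have *: "(\<chi>, T \<chi>) \<in> hom_step G H ?D ^^ m" if \<chi>: "\<chi> \<in> list_homs G H ?D" for \<chi>
  proof -
    have "(\<lambda>u\<in>pverts G. id (restrict id (pverts H) (\<chi> u)), \<lambda>u\<in>pverts G. id (t (\<chi> u)))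
      \<in> hom_step G H ?D ^^ m"
    proof (rule hom_step_map[OF G(1), where h = id and C = "pin_lists E {} id" and K = H])
      show "\<chi> \<in> graph_homs G H" using \<chi> by (simp add: list_homs_def)
      show "id a \<in> ?D u" if "u \<in> pverts G" "a \<in> pverts H" "a \<in> pin_lists E {} id (\<chi> u)" for u a
        using that list_homsD(4)[OF \<chi>, of u] by (auto simp: pin_lists_def intro: even_conn_trans)
      show "(restrict id (pverts H), t) \<in> hom_step H H (pin_lists E {} id) ^^ m"
        by (rule foldsD(2)[OF f])
    qed auto
    moreover have "(\<lambda>u\<in>pverts G. id (restrict id (pverts H) (\<chi> u))) = \<chi>"
      using list_homsD[OF \<chi>] by (auto simp: fun_eq_iff extensional_def restrict_def)
    ultimately show ?thesis by (simp add: T_def)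
  qed
  have "T \<phi> = T \<psi>"
    unfolding T_def
  proof (rule restrict_ext)
    fix u assume u: "u \<in> pverts G"
    note in_V = list_homsD(2)[OF \<phi> u, simplified] list_homsD(2)[OF \<psi> u, simplified]
    have "even_conn E (\<phi> u) (\<psi> u)"
      using list_homsD(4)[OF \<psi> u] symE by (auto simp: pin_lists_def intro: even_conn_sym)
    then have "even_conn E (t (\<phi> u)) (t (\<psi> u))"
      by (rule even_conn_map[rotated]) (rule th(3))
    then show "t (\<phi> u) = t (\<psi> u)" using S t(4) in_V by blast
  qed
  moreover have "(T \<psi>, \<psi>) \<in> hom_step G H ?D ^^ m"
    using *[OF \<psi>] sym_relpow[OF sym_hom_step[of G H]] G(2) symE by (auto dest: symD)
  ultimately have "(\<phi>, \<psi>) \<in> hom_step G H ?D ^^ (m + m)"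
    using *[OF \<phi>] unfolding relpow_add by auto
  then show ?thesis using that m by (simp add: mult_2)
qed

text \<open>
  One coordinate of \<open>F (\<psi>, \<dots>, \<psi>, \<chi>, \<phi>, \<dots>, \<phi>)\<close> at a time walks from \<open>\<phi>\<close> to \<open>\<psi>\<close>. Where \<open>\<phi>\<close> and
  \<open>\<psi>\<close> agree, the near unanimity identity makes \<open>\<chi>\<close> irrelevant, so the pins are respected.
  The first and the last of the \<open>k\<close> coordinates need not be moved.
\<close>
lemma pinned_walk:
  assumes G: "parcs G \<subseteq> pverts G \<times> pverts G" "sym (parcs G)"
    and \<phi>: "\<phi> \<in> list_homs G H (pin_lists E P \<phi>)" and \<psi>: "\<psi> \<in> list_homs G H (pin_lists E P \<phi>)"
  obtains m where "m \<le> card V" "(\<phi>, \<psi>) \<in> hom_step G H (pin_lists E P \<phi>) ^^ ((k - 2) * (2 * m))"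
proof -
  let ?C = "pin_lists E {} \<phi>" and ?D = "pin_lists E P \<phi>"
  have "\<phi> \<in> list_homs G H ?C" "\<psi> \<in> list_homs G H ?C"
    using \<phi> \<psi> by (auto simp: list_homs_def pin_lists_def)
  then obtain m where m: "m \<le> card V" "(\<phi>, \<psi>) \<in> hom_step G H ?C ^^ (2 * m)"
    using unpinned_walk[OF G] by blast
  define a where "a j \<chi> u = (\<lambda>i. if i < j then \<psi> u else if i = j then \<chi> u else \<phi> u)"
    for j :: nat and \<chi> u
  define A where "A j \<chi> = (\<lambda>u\<in>pverts G. F (a j \<chi> u))" for j \<chi>
  have in_G: "u \<in> pverts G" "v \<in> pverts G" if "(u, v) \<in> parcs G" for u v
    using that G by auto
  note \<phi>D = list_homsD[OF \<phi>, simplified] and \<psi>D = list_homsD[OF \<psi>, simplified]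
  have A: "A j \<chi> \<in> list_homs G H ?D" if \<chi>: "\<chi> \<in> list_homs G H ?C" for j \<chi>
  proof (rule list_homsI)
    note \<chi>D = list_homsD[OF \<chi>, simplified]
    have aV: "a j \<chi> u i \<in> V" if "u \<in> pverts G" for u i
      using that \<phi>D(2) \<psi>D(2) \<chi>D(2) by (auto simp: a_def)
    show "A j \<chi> u \<in> pverts H" if "u \<in> pverts G" for u
      using that aV by (auto simp: A_def intro!: F_closed)
    show "(A j \<chi> u, A j \<chi> v) \<in> parcs H" if "(u, v) \<in> parcs G" for u v
      using that \<phi>D(3) \<psi>D(3) \<chi>D(3) by (auto simp: A_def a_def in_G intro!: F_edge)
    show "A j \<chi> u \<in> ?D u" if u: "u \<in> pverts G" for u
    proof -
      have "even_conn E (a j \<chi> u i) (\<phi> u)" for i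
        using \<psi>D(4)[OF u] \<chi>D(4)[OF u] by (auto simp: a_def pin_lists_def)
      then have "even_conn E (F (a j \<chi> u)) (\<phi> u)"
        using aV[OF u] \<phi>D(2)[OF u] by (intro F_even_conn)
      moreover have "F (a j \<chi> u) = \<phi> u" if "u \<in> P"
        using \<psi>D(4)[OF u] that aV[OF u] by (intro F_nu[of _ j]) (auto simp: a_def pin_lists_def)
      ultimately show ?thesis using u by (simp add: A_def pin_lists_def)
    qed
  qed (simp add: A_def)
  have step: "(A j \<chi>, A j \<chi>') \<in> hom_step G H ?D" if "(\<chi>, \<chi>') \<in> hom_step G H ?C" for j \<chi> \<chi>'
  proof (intro hom_stepI A hom_stepD[OF that])
    fix u v assume uv: "(u, v) \<in> parcs G"
    then show "(A j \<chi> u, A j \<chi>' v) \<in> parcs H"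
      using hom_stepD(3)[OF that uv] \<phi>D(3)[OF uv] \<psi>D(3)[OF uv]
      by (auto simp: A_def a_def in_G intro!: F_edge)
  qed
  have piece: "(A j \<phi>, A (Suc j) \<phi>) \<in> hom_step G H ?D ^^ (2 * m)" for j
  proof -
    have "A j \<psi> = A (Suc j) \<phi>" by (auto simp: A_def a_def less_Suc_eq intro!: restrict_ext arg_cong[of _ _ F])
    then show ?thesis using relpow_map[of _ "A j" "hom_step G H ?D", OF step m(2)] by simp
  qed
  have chain: "(A 1 \<phi>, A (Suc n) \<phi>) \<in> hom_step G H ?D ^^ (n * (2 * m))" for n
  proof (induction n)
    case (Suc n)
    have "(A 1 \<phi>, A (Suc (Suc n)) \<phi>) \<in> hom_step G H ?D ^^ (n * (2 * m) + 2 * m)"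
      unfolding relpow_add using Suc piece by (rule relcompI)
    then show ?case by (simp add: add.commute)
  qed simp
  \<comment> \<open>At each end of the chain all coordinates but one agree: coordinate
    \<open>0\<close> is the exception at the start, coordinate \<open>k - 1\<close> at the
    end.\<close>
  have "A 1 \<phi> = \<phi>"
  proof
    fix u show "A 1 \<phi> u = \<phi> u"
    proof (cases "u \<in> pverts G")
      case True
      then have "F (a 1 \<phi> u) = \<phi> u" using \<phi>D(2) \<psi>D(2) by (intro F_nu[of _ 0]) (auto simp: a_def)
      then show ?thesis using True by (simp add: A_def)
    qed (use \<phi>D(1) in \<open>simp add: A_def extensional_def\<close>)
  qed
  moreover have "A (Suc (k - 2)) \<phi> = \<psi>"
  proof
    fix u show "A (Suc (k - 2)) \<phi> u = \<psi> u"
    proof (cases "u \<in> pverts G")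
      case True
      then have "F (a (Suc (k - 2)) \<phi> u) = \<psi> u"
        using \<phi>D(2) \<psi>D(2) by (intro F_nu[of _ "k - 1"]) (auto simp: a_def)
      then show ?thesis using True by (simp add: A_def)
    qed (use \<psi>D(1) in \<open>simp add: A_def extensional_def\<close>)
  qed
  ultimately show ?thesis using chain[of "k - 2"] that m(1) by simp
qed

end

section \<open>Folding the square onto the diagonal\<close>

context nu_structure
begin

text \<open>A pair can reach the diagonal with each coordinate staying in its class of
  \<open>even_conn\<close> only if its entries are joined by an even walk; the other pairs are left
  out.\<close>

definition even_square :: "('b \<times> 'b) pair_pre_digraph" where
  "even_square = \<lparr>pverts = {(x, y) \<in> V \<times> V. even_conn E x y},
     parcs = {((x, y), (x', y')). (x, x') \<in> E \<and> (y, y') \<in> E \<and> even_conn E x y \<and> even_conn E x' y'}\<rparr>"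

text \<open>Diagonal pairs never move: they arise where two homomorphisms agree, in particular at
  precoloured vertices.\<close>

definition square_lists :: "'b \<times> 'b \<Rightarrow> ('b \<times> 'b) set" where
  "square_lists = (\<lambda>(x, y). {(a, b). even_conn E a x \<and> even_conn E b y \<and> (x = y \<longrightarrow> a = x \<and> b = x)})"

lemma even_conn_edges:
  assumes "(x, x') \<in> E" "(y, y') \<in> E" "even_conn E x y"
  shows "even_conn E x' y'"
proof -
  obtain a where "(x, y) \<in> E ^^ (2 * a)" using assms(3) by (auto simp: even_conn_def)
  then have "(x', y') \<in> E ^^ Suc (Suc (2 * a))"
    using assms(1,2) symE by (meson relpow_Suc_I relpow_Suc_I2 symD)
  then show ?thesis unfolding even_conn_def by (intro exI[of _ "Suc a"]) simp
qed

lemma in_square: "q \<in> pverts even_square \<longleftrightarrow> fst q \<in> V \<and> snd q \<in> V \<and> even_conn E (fst q) (snd q)"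
  by (cases q) (simp add: even_square_def)

lemma square_edge: "(q, r) \<in> parcs even_square \<longleftrightarrow>
    (fst q, fst r) \<in> E \<and> (snd q, snd r) \<in> E \<and> even_conn E (fst q) (snd q)"
  by (cases q; cases r) (auto simp: even_square_def dest: even_conn_edges)

lemma square_wf: "parcs even_square \<subseteq> pverts even_square \<times> pverts even_square"
proof
  fix e assume e: "e \<in> parcs even_square"
  obtain q r where qr: "e = (q, r)" by (cases e)
  then show "e \<in> pverts even_square \<times> pverts even_square"
    using e E_in[of "fst q" "fst r"] E_in[of "snd q" "snd r"]
      even_conn_edges[of "fst q" "fst r" "snd q" "snd r"]
    by (simp add: in_square square_edge)
qed

lemma sym_square: "sym (parcs even_square)"
proof (rule symI)
  fix q r assume qr: "(q, r) \<in> parcs even_square"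
  then have "(fst r, fst q) \<in> E" "(snd r, snd q) \<in> E" using symE by (auto simp: square_edge dest: symD)
  moreover have "even_conn E (fst r) (snd r)"
    using qr even_conn_edges[of "fst q" "fst r" "snd q" "snd r"] by (simp add: square_edge)
  ultimately show "(r, q) \<in> parcs even_square" by (simp add: square_edge)
qed

lemma square_swap: "(prod.swap q, r) \<in> parcs even_square \<longleftrightarrow> (q, prod.swap r) \<in> parcs even_square"
  using even_conn_sym[OF symE, of "fst q" "snd q"] even_conn_sym[OF symE, of "snd q" "fst q"]
  by (auto simp: square_edge)

lemma square_nbr: "q \<in> pverts even_square \<Longrightarrow> \<exists>r. (q, r) \<in> parcs even_square"
  using nbr[of "fst q"] nbr[of "snd q"] by (auto simp: in_square square_edge)

lemma in_square_lists: "r \<in> square_lists q \<longleftrightarrow>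
    even_conn E (fst r) (fst q) \<and> even_conn E (snd r) (snd q) \<and> (fst q = snd q \<longrightarrow> r = q)"
  by (cases q; cases r) (auto simp: square_lists_def)

text \<open>
  The pinned walk from the first to the second projection of \<open>S\<close> gives a walk of maps \<open>S \<rightarrow> S\<close> from the
  identity into the diagonal. Its first map that does more than swapping twins exhibits a fold.
\<close>
lemma ex_symmetric_fold:
  assumes f: "folds even_square square_lists m S t"
    and swap: "\<And>q. q \<in> S \<Longrightarrow> prod.swap q \<in> S" and q0: "q\<^sub>0 \<in> S" "fst q\<^sub>0 \<noteq> snd q\<^sub>0"
  obtains q q' where "q \<in> S" "q' \<in> S" "fst q \<noteq> snd q" "q' \<noteq> q" "q' \<noteq> prod.swap q"
    "\<And>z. z \<in> S \<Longrightarrow> (q, z) \<in> parcs even_square \<Longrightarrow> (q', z) \<in> parcs even_square"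
proof (rule ccontr)
  let ?A = "parcs even_square"
  assume no: "\<not> thesis"
  note foldI = that
  have no_fold: "q' = q \<or> q' = prod.swap q" if "q \<in> S" "q' \<in> S" "fst q \<noteq> snd q"
    "\<And>z. z \<in> S \<Longrightarrow> (q, z) \<in> ?A \<Longrightarrow> (q', z) \<in> ?A" for q q'
  proof (rule ccontr)
    assume "\<not> ?thesis"
    then show False using no foldI[OF that(1-3) _ _ that(4)] by blast
  qed
  note t = foldsD[OF f]
  note th = list_homsD[OF t(1)]
  define GS where "GS = \<lparr>pverts = S, parcs = ?A \<inter> S \<times> S\<rparr>"
  define \<phi> where "\<phi> = restrict fst S"
  define \<psi> where "\<psi> = restrict snd S"
  let ?D = "pin_lists E {q. fst q = snd q} \<phi>"
  have \<phi>: "\<phi> \<in> list_homs GS H ?D"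
    using t(3) by (intro list_homsI)
      (auto simp: GS_def \<phi>_def pin_lists_def in_square square_edge)
  have \<psi>: "\<psi> \<in> list_homs GS H ?D"
    using t(3) symE by (intro list_homsI)
      (auto simp: GS_def \<phi>_def \<psi>_def pin_lists_def in_square square_edge intro: even_conn_sym)
  have GS: "parcs GS \<subseteq> pverts GS \<times> pverts GS" "sym (parcs GS)"
    using sym_square by (auto simp: GS_def intro!: symI dest: symD)
  obtain n where walk: "(\<phi>, \<psi>) \<in> hom_step GS H ?D ^^ n"
    using pinned_walk[OF GS \<phi> \<psi>] by blast
  \<comment> \<open>\<open>h \<phi>\<close> is the identity on \<open>S\<close> and
    \<open>h \<psi>\<close> maps into the diagonal; \<open>t\<close> brings the intermediate pairs
    back into \<open>S\<close>.\<close>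
  define h where "h \<chi> q = t (\<chi> q, snd q)" for \<chi> :: "'b \<times> 'b \<Rightarrow> 'b" and q :: "'b \<times> 'b"
  \<comment> \<open>The invariant: each pair is fixed or swapped, without changing its neighbours in
    \<open>S\<close>.\<close>
  let ?I = "\<lambda>\<chi>. \<forall>q\<in>S. (h \<chi> q = q \<or> h \<chi> q = prod.swap q) \<and> (\<forall>z\<in>S. (q, z) \<in> ?A \<longleftrightarrow> (h \<chi> q, z) \<in> ?A)"
  have "?I \<psi>"
  proof (rule relpow_invariant[OF walk, of ?I])
    show "?I \<phi>" using t(5) by (simp add: h_def \<phi>_def)
  next
    fix \<chi> \<chi>' assume I: "?I \<chi>" and step: "(\<chi>, \<chi>') \<in> hom_step GS H ?D"
    note \<chi>D = list_homsD[OF hom_stepD(1)[OF step], unfolded GS_def, simplified]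
    note \<chi>D' = list_homsD[OF hom_stepD(2)[OF step], unfolded GS_def, simplified]
    have even: "even_conn E (\<chi> q) (snd q)" "even_conn E (\<chi>' q) (snd q)" if "q \<in> S" for q
      using \<chi>D(4)[OF that] \<chi>D'(4)[OF that] t(3)[OF that] that
      by (auto simp: pin_lists_def \<phi>_def in_square intro: even_conn_trans)
    have hS: "h \<chi> q \<in> S" "h \<chi>' q \<in> S" if "q \<in> S" for q
      using \<chi>D(2)[OF that] \<chi>D'(2)[OF that] even[OF that] t(3)[OF that]
      by (auto simp: h_def in_square intro!: t(4))
    \<comment> \<open>The step gives an edge between \<open>h \<chi> z\<close> and
      \<open>h \<chi>' q\<close>, and \<open>h \<chi> z\<close> has the same neighbours in
      \<open>S\<close> as \<open>z\<close>. So \<open>h \<chi>' q\<close> dominates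
      \<open>q\<close>; off the diagonal, the absence of folds makes it \<open>q\<close> or its
      mirror image.\<close>
    have sub: "(h \<chi>' q, z) \<in> ?A" if "q \<in> S" "z \<in> S" "(q, z) \<in> ?A" for q z
    proof -
      have zq: "(z, q) \<in> ?A" using that sym_square by (auto dest: symD)
      then have "(\<chi> z, \<chi>' q) \<in> E"
        using hom_stepD(3)[OF step, of z q] that by (simp add: GS_def)
      then have "((\<chi> z, snd z), (\<chi>' q, snd q)) \<in> ?A"
        using zq even(1)[OF that(2)] by (simp add: square_edge)
      then have "(h \<chi> z, h \<chi>' q) \<in> ?A" unfolding h_def by (rule th(3))
      then have "(z, h \<chi>' q) \<in> ?A" using I that hS by blast
      then show ?thesis using sym_square by (auto dest: symD)
    qed
    show "?I \<chi>'"
    proof (intro ballI conjI iffI)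
      fix q assume q: "q \<in> S"
      show *: "h \<chi>' q = q \<or> h \<chi>' q = prod.swap q"
      proof (cases "fst q = snd q")
        case True
        then have "\<chi>' q = fst q" using \<chi>D'(4)[OF q] q by (simp add: pin_lists_def \<phi>_def)
        then have "(\<chi>' q, snd q) = q" using True by (simp add: prod_eq_iff)
        then show ?thesis using t(5)[OF q] by (simp add: h_def)
      next
        case False
        then show ?thesis using no_fold[OF q hS(2)[OF q]] sub[OF q] by blast
      qed
      fix z assume z: "z \<in> S"
      show "(h \<chi>' q, z) \<in> ?A" if "(q, z) \<in> ?A" using sub q z that by blast
      assume hz: "(h \<chi>' q, z) \<in> ?A"
      show "(q, z) \<in> ?A"
      proof (cases "h \<chi>' q = q")
        \<comment> \<open>Domination of \<open>q\<close> by its mirror image, applied to the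
          mirrored neighbour, gives the reverse inclusion.\<close>
        case False
        then have sq: "h \<chi>' q = prod.swap q" using * by blast
        then have "(q, prod.swap z) \<in> ?A" using hz square_swap by simp
        then have "(prod.swap q, prod.swap z) \<in> ?A" using sub[OF q swap[OF z]] sq by simp
        then show ?thesis by (simp add: square_swap)
      qed (use hz in simp)
    qed
  qed
  then have "h \<psi> q\<^sub>0 = q\<^sub>0 \<or> h \<psi> q\<^sub>0 = prod.swap q\<^sub>0" using q0(1) by blast
  moreover have "h \<psi> q\<^sub>0 = (snd q\<^sub>0, snd q\<^sub>0)"
  proof -
    have "(snd q\<^sub>0, snd q\<^sub>0) \<in> pverts even_square" using t(3)[OF q0(1)] by (simp add: in_square)
    then have "t (snd q\<^sub>0, snd q\<^sub>0) = (snd q\<^sub>0, snd q\<^sub>0)" using th(4) by (auto simp: in_square_lists)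
    then show ?thesis using q0(1) by (simp add: h_def \<psi>_def)
  qed
  ultimately show False using q0(2) by (cases q\<^sub>0) auto
qed

text \<open>In a smallest swap-invariant set reached by folds, an off-diagonal pair would allow a
  fold of some \<open>q\<close> together with its mirror image. Each step removes two pairs, so
  \<open>2 * m + card S\<close> is constant.\<close>

lemma ex_diagonal_folds:
  obtains m S t where "folds even_square square_lists m S t" "2 * m \<le> card V * card V"
    "\<And>q. q \<in> S \<Longrightarrow> fst q = snd q"
proof -
  let ?A = "parcs even_square"
  let ?P = "\<lambda>(m, S, t). folds even_square square_lists m S t \<and> prod.swap ` S \<subseteq> S \<and>
    2 * m + card S = card (pverts even_square)"
  have "?P (0, pverts even_square, restrict id (pverts even_square))"
    using folds_0[OF square_wf, of square_lists] even_conn_sym[OF symE]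
    by (auto simp: in_square_lists in_square)
  then have "\<exists>M. ?P M \<and> (\<forall>M'. ?P M' \<longrightarrow> card (fst (snd M)) \<le> card (fst (snd M')))"
    by (rule ex_has_least_nat)
  then obtain M where M: "?P M" "\<And>M'. ?P M' \<Longrightarrow> card (fst (snd M)) \<le> card (fst (snd M'))"
    by (elim exE conjE) (rule that, assumption, erule allE, erule mp)
  obtain m S t where mst: "M = (m, S, t)" by (cases M) auto
  have f: "folds even_square square_lists m S t" and swap: "\<And>q. q \<in> S \<Longrightarrow> prod.swap q \<in> S"
    and card: "2 * m + card S = card (pverts even_square)"
    using M(1) mst by auto
  note t = foldsD[OF f]
  note th = list_homsD[OF t(1)]
  have sub: "pverts even_square \<subseteq> V \<times> V" by (auto simp: in_square)
  then have "finite (pverts even_square)" using fin finite_subset by blast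
  then have finS: "finite S" using t(3) finite_subset[of S] by blast
  have "card (pverts even_square) \<le> card (V \<times> V)" using sub fin by (intro card_mono) auto
  then have "2 * m \<le> card V * card V" using card by (simp add: card_cartesian_product)
  moreover have "fst q = snd q" if "q \<in> S" for q
  proof (rule ccontr)
    assume "fst q \<noteq> snd q"
    then obtain q q' where q: "q \<in> S" "q' \<in> S" "fst q \<noteq> snd q" "q' \<noteq> q" "q' \<noteq> prod.swap q"
      and fold: "\<And>z. z \<in> S \<Longrightarrow> (q, z) \<in> ?A \<Longrightarrow> (q', z) \<in> ?A"
      using ex_symmetric_fold[OF f swap \<open>q \<in> S\<close>] by blast
    have sq: "prod.swap q \<noteq> q" using q(3) by (cases q) auto
    have sq': "prod.swap q' \<noteq> q" "prod.swap q' \<noteq> prod.swap q"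
      using q(4,5) by (auto simp: prod_eq_iff)
    have fold': "(prod.swap q', z) \<in> ?A" if "z \<in> S" "(prod.swap q, z) \<in> ?A" for z
      using that fold[OF swap] by (simp add: square_swap)
    \<comment> \<open>Since \<open>q'\<close> is neither \<open>q\<close> nor its mirror image, both
      targets survive the step.\<close>
    define s where "s z = (if z = q then q' else if z = prod.swap q then prod.swap q' else z)" for z
    let ?S = "S - {q, prod.swap q}"
    \<comment> \<open>The common neighbour \<open>t r\<close> of \<open>q\<close> and
      \<open>q'\<close> shows that the fold keeps each coordinate in its class.\<close>
    obtain r where "(q, r) \<in> ?A" using square_nbr t(3) q(1) by blast
    then have "(q, t r) \<in> ?A" "t r \<in> S"
      using th(3)[of q r] t(4)[of r] t(5)[OF q(1)] square_wf by auto
    then have "(q', t r) \<in> ?A" using fold by blast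
    then have even: "even_conn E (fst q') (fst q)" "even_conn E (snd q') (snd q)"
      using \<open>(q, t r) \<in> ?A\<close> symD[OF symE] unfolding square_edge
      by (blast intro: even_conn_two_step)+
    have "folds even_square square_lists (Suc m) ?S (\<lambda>x\<in>pverts even_square. s (t x))"
    proof (rule folds_Suc[OF f square_wf sym_square])
      show "s x \<in> ?S" if "x \<in> S" for x
        using that q sq' swap by (auto simp: s_def)
      show "(s x, y) \<in> ?A" if "x \<in> S" "y \<in> S" "(x, y) \<in> ?A" for x y
        using that(3) fold[OF that(2)] fold'[OF that(2)] by (auto simp: s_def)
      show "s (t x) \<in> square_lists x" if "x \<in> pverts even_square" for x
        using th(4)[OF that] even q(3)
        by (auto simp: s_def in_square_lists intro: even_conn_trans)
    qed (auto simp: s_def)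
    moreover have "prod.swap ` ?S \<subseteq> ?S"
    proof (rule image_subsetI)
      fix z assume z: "z \<in> ?S"
      have "prod.swap z \<noteq> q" "prod.swap z \<noteq> prod.swap q"
        using z by (auto simp: prod_eq_iff)
      then show "prod.swap z \<in> ?S" using z swap by simp
    qed
    moreover have cS: "card ?S + 2 = card S"
    proof -
      have "card {q, prod.swap q} = 2" using sq by simp
      moreover have "{q, prod.swap q} \<subseteq> S" using q(1) swap by auto
      ultimately show ?thesis
        using card_Diff_subset[of "{q, prod.swap q}" S] card_mono[of S "{q, prod.swap q}"] finS by simp
    qed
    ultimately have "?P (Suc m, ?S, \<lambda>x\<in>pverts even_square. s (t x))" using card by simp
    from M(2)[OF this] show False using cS mst by simp
  qed
  ultimately show ?thesis using that f by blast
qed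

text \<open>The pair of \<open>\<phi>\<close> and \<open>\<psi>\<close> is a homomorphism into the
  square. Folding onto the diagonal moves both coordinates to a common map, in \<open>m\<close>
  steps from either side; pinned vertices lie on the diagonal and stay.\<close>

lemma square_walk:
  assumes G: "parcs G \<subseteq> pverts G \<times> pverts G" "sym (parcs G)"
    and \<phi>: "\<phi> \<in> list_homs G H (pin_lists E P \<phi>)" and \<psi>: "\<psi> \<in> list_homs G H (pin_lists E P \<phi>)"
  obtains m where "2 * m \<le> card V * card V" "(\<phi>, \<psi>) \<in> hom_step G H (pin_lists E P \<phi>) ^^ (2 * m)"
proof -
  let ?D = "pin_lists E P \<phi>" and ?R = "restrict id (pverts even_square)"
  obtain m S t where f: "folds even_square square_lists m S t" and m: "2 * m \<le> card V * card V"
    and S: "\<And>q. q \<in> S \<Longrightarrow> fst q = snd q"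
    using ex_diagonal_folds by blast
  note t = foldsD[OF f]
  note \<phi>D = list_homsD[OF \<phi>, simplified] and \<psi>D = list_homsD[OF \<psi>, simplified]
  have in_G: "u \<in> pverts G" "v \<in> pverts G" if "(u, v) \<in> parcs G" for u v
    using that G by auto
  define \<chi> where "\<chi> = (\<lambda>u\<in>pverts G. (\<phi> u, \<psi> u))"
  have even: "even_conn E (\<phi> u) (\<psi> u)" if "u \<in> pverts G" for u
    using \<psi>D(4)[OF that] symE by (auto simp: pin_lists_def intro: even_conn_sym)
  have \<chi>: "\<chi> u \<in> pverts even_square" if "u \<in> pverts G" for u
    using that \<phi>D(2) \<psi>D(2) even by (simp add: \<chi>_def in_square)
  have \<chi>_hom: "\<chi> \<in> graph_homs G even_square"
    using \<chi> \<phi>D(3) \<psi>D(3) even by (auto simp: graph_homs_def \<chi>_def square_edge in_G)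
  have walk: "(\<lambda>u\<in>pverts G. p (?R (\<chi> u)), \<lambda>u\<in>pverts G. p (t (\<chi> u))) \<in> hom_step G H ?D ^^ m"
    if p: "p = fst \<or> p = snd" for p
  proof (rule hom_step_map[OF G(1) \<chi>_hom _ _ _ t(2)])
    show "p a \<in> ?D u" if "u \<in> pverts G" "a \<in> pverts even_square" "a \<in> square_lists (\<chi> u)" for u a
      using that p \<psi>D(4)[OF that(1)]
      by (auto simp: pin_lists_def in_square_lists \<chi>_def intro: even_conn_trans)
  qed (use p in \<open>auto simp: in_square square_edge\<close>)
  have "(\<phi>, \<lambda>u\<in>pverts G. fst (t (\<chi> u))) \<in> hom_step G H ?D ^^ m"
  proof -
    have "(\<lambda>u\<in>pverts G. fst (?R (\<chi> u))) = \<phi>"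
      using \<chi> \<phi>D(1) by (auto simp: \<chi>_def extensional_def fun_eq_iff)
    then show ?thesis using walk[of fst] by simp
  qed
  moreover have "(\<lambda>u\<in>pverts G. fst (t (\<chi> u)), \<psi>) \<in> hom_step G H ?D ^^ m"
  proof -
    have "(\<lambda>u\<in>pverts G. snd (?R (\<chi> u))) = \<psi>"
      using \<chi> \<psi>D(1) by (auto simp: \<chi>_def extensional_def fun_eq_iff)
    moreover have "(\<lambda>u\<in>pverts G. snd (t (\<chi> u))) = (\<lambda>u\<in>pverts G. fst (t (\<chi> u)))"
      using S t(4) \<chi> by (intro restrict_ext) simp
    ultimately have "(\<psi>, \<lambda>u\<in>pverts G. fst (t (\<chi> u))) \<in> hom_step G H ?D ^^ m"
      using walk[of snd] by simp
    then show ?thesis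
      using sym_relpow[OF sym_hom_step[of G H]] G(2) symE by (auto dest: symD)
  qed
  ultimately have "(\<phi>, \<psi>) \<in> hom_step G H ?D ^^ (m + m)"
    unfolding relpow_add by (rule relcompI)
  then show ?thesis using that m by (simp add: mult_2)
qed

theorem short_pinned_walk:
  assumes "parcs G \<subseteq> pverts G \<times> pverts G" "sym (parcs G)"
    and "\<phi> \<in> list_homs G H (pin_lists E P \<phi>)" "\<psi> \<in> list_homs G H (pin_lists E P \<phi>)"
  obtains d where "d \<le> card V * min (2 * (k - 2)) (card V)"
    "(\<phi>, \<psi>) \<in> hom_step G H (pin_lists E P \<phi>) ^^ d"
proof (cases "2 * (k - 2) \<le> card V")
  case True
  obtain m where "m \<le> card V" "(\<phi>, \<psi>) \<in> hom_step G H (pin_lists E P \<phi>) ^^ ((k - 2) * (2 * m))"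
    using pinned_walk[OF assms] by blast
  moreover from this have "(k - 2) * (2 * m) \<le> card V * (2 * (k - 2))" by simp
  ultimately show ?thesis using True by (intro that[of "(k - 2) * (2 * m)"]) (simp_all add: min_def)
next
  case False
  obtain m where "2 * m \<le> card V * card V" "(\<phi>, \<psi>) \<in> hom_step G H (pin_lists E P \<phi>) ^^ (2 * m)"
    using square_walk[OF assms] by blast
  then show ?thesis using False by (intro that[of "2 * m"]) (simp_all add: min_def)
qed

end

section \<open>Homomorphisms extending a precolouring\<close>

lemma (in wf_digraph) relpow_awalk:
  assumes "(u, v) \<in> arcs_ends G ^^ n" "u \<in> verts G"
  shows "\<exists>p. awalk u p v \<and> length p = n"
  using assms
proof (induction n arbitrary: u)
  case 0
  then show ?case by (auto simp: awalk_Nil_iff)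
next
  case (Suc n)
  then obtain w where w: "(u, w) \<in> arcs_ends G" "(w, v) \<in> arcs_ends G ^^ n"
    by (meson relpow_Suc_D2)
  then obtain e where e: "e \<in> arcs G" "tail G e = u" "head G e = w"
    by (auto simp: arcs_ends_conv)
  moreover from e have "w \<in> verts G" by auto
  then obtain p where "awalk w p v" "length p = n" using Suc.IH w(2) by blast
  ultimately show ?case by (intro exI[of _ "e # p"]) (auto simp: awalk_Cons_iff)
qed

lemma (in pair_pseudo_graph) sym_parcs: "sym (parcs G)"
  using pair_sym_arcs by (simp add: symmetric_def)

lemma (in pair_pseudo_graph) parcs_subset: "parcs G \<subseteq> pverts G \<times> pverts G"
  by (auto dest: in_arcsD1 in_arcsD2)

lemma (in pair_pseudo_graph) connected_relpow:
  assumes "connected (with_proj G)" "x \<in> pverts G" "y \<in> pverts G"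
  obtains n where "(x, y) \<in> parcs G ^^ n"
proof -
  have "parcs (mk_symmetric (with_proj G)) = parcs G"
    using sym_parcs by (auto simp: mk_symmetric_def dest: symD)
  moreover have "x \<rightarrow>\<^sup>*\<^bsub>with_proj (mk_symmetric (with_proj G))\<^esub> y"
    using assms by (auto simp: connected_def strongly_connected_def mk_symmetric_def)
  ultimately have "(x, y) \<in> (parcs G)\<^sup>*"
    by (auto simp: reachable_def dest: rtrancl_on_rtranclI)
  then show ?thesis using that by (auto dest: rtrancl_imp_relpow)
qed

text \<open>\<open>f\<close> acts on extensional tuples, so sequences are first restricted to
  \<open>{..<k}\<close>. A connected graph violating \<open>nbr\<close> is a single vertex without a
  loop and is treated separately.\<close>

lemma nu_structure_if_NU_graph:
  assumes k: "k \<ge> 3" and H: "pair_pseudo_graph H" and "NU_graph k H"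
    and nbr: "\<And>x. x \<in> pverts H \<Longrightarrow> \<exists>y. (x, y) \<in> parcs H"
  obtains F where "nu_structure (pverts H) (parcs H) k F"
proof -
  interpret H: pair_pseudo_graph H by (rule H)
  obtain f where f: "f \<in> graph_homs (graph_power H k) H"
    and nu: "\<And>xs x. xs \<in> pverts (graph_power H k) \<Longrightarrow> x \<in> pverts H \<Longrightarrow>
      card {i \<in> {..<k}. xs i = x} \<ge> k - 1 \<Longrightarrow> f xs = x"
    using assms(3) unfolding NU_graph_def by blast
  have "nu_structure (pverts H) (parcs H) k (\<lambda>t. f (restrict t {..<k}))"
  proof (rule nu_structure.intro)
    fix s t :: "nat \<Rightarrow> 'a" assume st: "\<And>i. i < k \<Longrightarrow> (s i, t i) \<in> parcs H"
    then have "(restrict s {..<k}, restrict t {..<k}) \<in> parcs (graph_power H k)"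
      using H.in_arcsD1 H.in_arcsD2 by (fastforce simp: graph_power_def Let_def)
    then show "(f (restrict s {..<k}), f (restrict t {..<k})) \<in> parcs H"
      using f by (auto simp: graph_homs_def)
  next
    fix t :: "nat \<Rightarrow> 'a" and x j
    assume t: "\<And>i. i < k \<Longrightarrow> t i \<in> pverts H" "\<And>i. i < k \<Longrightarrow> i \<noteq> j \<Longrightarrow> t i = x"
    obtain i where i: "i < k" "i \<noteq> j"
      using k by (cases "j = 0") (auto intro: that[of 0] that[of 1])
    \<comment> \<open>For \<open>j \<ge> k\<close> nothing is removed, so the bound holds for every
      \<open>j\<close>.\<close>
    have "k - 1 \<le> card ({..<k} - {j})" by (simp add: card_Diff_singleton_if)
    also have "\<dots> \<le> card {i \<in> {..<k}. restrict t {..<k} i = x}"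
      using t(2) by (intro card_mono) auto
    finally show "f (restrict t {..<k}) = x"
      using t i by (intro nu) (auto simp: graph_power_def Let_def)
  qed (use k nbr H.pair_finite_verts H.parcs_subset H.sym_parcs in auto)
  then show ?thesis using that by blast
qed

section \<open>Parity of walks and colour classes\<close>

lemma bipartition_relpow:
  assumes "bipartition H B W" "(x, y) \<in> parcs H ^^ n"
  shows "even n \<Longrightarrow> (x \<in> B \<longleftrightarrow> y \<in> B)" "odd n \<Longrightarrow> (x \<in> B \<longleftrightarrow> y \<notin> B)"
proof -
  have "(even n \<longrightarrow> (x \<in> B \<longleftrightarrow> y \<in> B)) \<and> (odd n \<longrightarrow> (x \<in> B \<longleftrightarrow> y \<notin> B))"
    using assms(2)
  proof (induction n arbitrary: y)
    case (Suc n)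
    then obtain z where z: "(x, z) \<in> parcs H ^^ n" "(z, y) \<in> parcs H" by auto
    then have "z \<in> B \<longleftrightarrow> y \<notin> B" using assms(1) by (auto simp: bipartition_def)
    then show ?case using Suc.IH[OF z(1)] by auto
  qed simp
  then show "even n \<Longrightarrow> (x \<in> B \<longleftrightarrow> y \<in> B)" "odd n \<Longrightarrow> (x \<in> B \<longleftrightarrow> y \<notin> B)" by auto
qed

lemma (in pair_pseudo_graph) even_conn_iff_same_class:
  assumes "connected (with_proj G)" "bipartition G B W" "x \<in> pverts G" "y \<in> pverts G"
  shows "even_conn (parcs G) x y \<longleftrightarrow> (x \<in> B \<longleftrightarrow> y \<in> B)"
proof
  assume "even_conn (parcs G) x y"
  then show "x \<in> B \<longleftrightarrow> y \<in> B"
    using bipartition_relpow(1)[OF assms(2)] by (auto simp: even_conn_def)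
next
  assume xy: "x \<in> B \<longleftrightarrow> y \<in> B"
  obtain n where n: "(x, y) \<in> parcs G ^^ n"
    by (rule connected_relpow[OF assms(1,3,4)])
  then have "even n" using bipartition_relpow(2)[OF assms(2)] xy by blast
  then show "even_conn (parcs G) x y" using n by (intro even_connI)
qed

text \<open>If no even walk reaches \<open>y\<close>, the vertices at the ends of even walks from
  \<open>x\<close> form a class of a bipartition: an edge inside it would close an odd walk at
  \<open>x\<close> and turn an odd walk to \<open>y\<close> into an even one; an edge outside it
  would extend an odd walk to an even one.\<close>

lemma (in pair_pseudo_graph) even_conn_if_not_bipartite:
  assumes conn: "connected (with_proj G)" and "\<not> bipartite G" "x \<in> pverts G" "y \<in> pverts G"
  shows "even_conn (parcs G) x y"
proof (rule ccontr)
  assume no: "\<not> even_conn (parcs G) x y"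
  have odd: "\<exists>n. odd n \<and> (x, z) \<in> parcs G ^^ n"
    if "z \<in> pverts G" "\<not> even_conn (parcs G) x z" for z
  proof -
    obtain n where n: "(x, z) \<in> parcs G ^^ n"
      by (rule connected_relpow[OF conn assms(3) \<open>z \<in> pverts G\<close>])
    then have "odd n" using that(2) even_connI[OF n] by blast
    then show ?thesis using n by blast
  qed
  define B where "B = {z \<in> pverts G. even_conn (parcs G) x z}"
  have edge: "u \<in> B \<longleftrightarrow> v \<notin> B" if uv: "(u, v) \<in> parcs G" for u v
  proof
    assume "u \<in> B"
    show "v \<notin> B"
    proof
      assume "v \<in> B"
      obtain a b where a: "(x, u) \<in> parcs G ^^ (2 * a)" and b: "(x, v) \<in> parcs G ^^ (2 * b)"
        using \<open>u \<in> B\<close> \<open>v \<in> B\<close> by (auto simp: B_def even_conn_def)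
      obtain n where n: "odd n" "(x, y) \<in> parcs G ^^ n" using odd[OF assms(4) no] by blast
      have "(x, v) \<in> parcs G ^^ Suc (2 * a)" using a uv by (rule relpow_Suc_I)
      moreover have "(v, x) \<in> parcs G ^^ (2 * b)" using b sym_relpow[OF sym_parcs] by (auto dest: symD)
      ultimately have "(x, y) \<in> parcs G ^^ (Suc (2 * a) + (2 * b + n))"
        using n(2) unfolding relpow_add by (rule relcompI[OF _ relcompI])
      moreover have "even (Suc (2 * a) + (2 * b + n))" using n(1) by simp
      ultimately have "even_conn (parcs G) x y" by (rule even_connI)
      then show False using no by simp
    qed
  next
    assume v: "v \<notin> B"
    have uvG: "u \<in> pverts G" "v \<in> pverts G" using uv in_arcsD1 in_arcsD2 by auto
    show "u \<in> B"
    proof (rule ccontr)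
      assume "u \<notin> B"
      then obtain n where n: "odd n" "(x, u) \<in> parcs G ^^ n" using odd[of u] uvG by (auto simp: B_def)
      then have "(x, v) \<in> parcs G ^^ Suc n" using uv by (auto intro: relpow_Suc_I)
      moreover have "even (Suc n)" using n(1) by simp
      ultimately have "even_conn (parcs G) x v" by (rule even_connI)
      then show False using v uvG by (simp add: B_def)
    qed
  qed
  then have "bipartition G B (pverts G - B)"
    using parcs_subset by (auto simp: bipartition_def B_def)
  then show False using assms(2) by (auto simp: bipartite_def)
qed

text \<open>The bipartition is pulled back along \<open>\<phi>\<close>. This gives access to the
  colour classes of \<open>G\<close>, which are fixed only for bipartite \<open>G\<close>.\<close>

lemma bipartite_if_hom:
  assumes "bipartite H" "\<phi> \<in> graph_homs G H" "parcs G \<subseteq> pverts G \<times> pverts G"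
  shows "bipartite G"
proof -
  obtain B W where BW: "bipartition H B W" using assms(1) by (auto simp: bipartite_def)
  have "bipartition G {u \<in> pverts G. \<phi> u \<in> B} {u \<in> pverts G. \<phi> u \<in> W}"
    unfolding bipartition_def
  proof (intro conjI)
    show "{u \<in> pverts G. \<phi> u \<in> B} \<union> {u \<in> pverts G. \<phi> u \<in> W} = pverts G"
      "{u \<in> pverts G. \<phi> u \<in> B} \<inter> {u \<in> pverts G. \<phi> u \<in> W} = {}"
      using assms(2) BW by (auto simp: bipartition_def graph_homs_def)
    show "\<forall>(u, v)\<in>parcs G. u \<in> {u \<in> pverts G. \<phi> u \<in> B} \<and> v \<in> {u \<in> pverts G. \<phi> u \<in> W} \<or>
        u \<in> {u \<in> pverts G. \<phi> u \<in> W} \<and> v \<in> {u \<in> pverts G. \<phi> u \<in> B}"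
    proof clarify
      fix u v assume uv: "(u, v) \<in> parcs G"
      then have "(\<phi> u, \<phi> v) \<in> parcs H" using assms(2) by (auto simp: graph_homs_def)
      then have "\<phi> u \<in> B \<and> \<phi> v \<in> W \<or> \<phi> u \<in> W \<and> \<phi> v \<in> B" using BW by (auto simp: bipartition_def)
      moreover have "u \<in> pverts G" "v \<in> pverts G" using uv assms(3) by auto
      ultimately show "u \<in> {u \<in> pverts G. \<phi> u \<in> B} \<and> v \<in> {u \<in> pverts G. \<phi> u \<in> W}"
        if "\<not> (u \<in> {u \<in> pverts G. \<phi> u \<in> W} \<and> v \<in> {u \<in> pverts G. \<phi> u \<in> B})" using that by blast
    qed
  qed
  then show ?thesis by (auto simp: bipartite_def)
qed

section \<open>Vertices and arcs of Hom_B, and the diameter bounds\<close>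

lemma verts_homB_graph:
  "\<phi> \<in> verts (homB_graph G H p BG WG BH WH) \<longleftrightarrow>
     \<phi> \<in> graph_homs G H \<and> (\<forall>v\<in>dom p. p v = Some (\<phi> v)) \<and>
     (bipartite H \<longrightarrow> \<phi> ` BG \<subseteq> BH \<and> \<phi> ` WG \<subseteq> WH)"
  by (auto simp: homB_graph_def hom_ext_graph_def)

lemma arcs_homB_graph:
  "arcs (homB_graph G H p BG WG BH WH) = {e \<in> parcs (hom_graph G H).
     fst e \<in> verts (homB_graph G H p BG WG BH WH) \<and> snd e \<in> verts (homB_graph G H p BG WG BH WH)}"
  by (auto simp: homB_graph_def hom_ext_graph_def)

lemma arcs_ends_homB_graph:
  assumes "\<phi> \<in> verts (homB_graph G H p BG WG BH WH)" "\<psi> \<in> verts (homB_graph G H p BG WG BH WH)"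
    "\<forall>(u, v)\<in>parcs G. (\<phi> u, \<psi> v) \<in> parcs H"
  shows "(\<phi>, \<psi>) \<in> arcs_ends (homB_graph G H p BG WG BH WH)"
proof -
  have "(\<phi>, \<psi>) \<in> parcs (hom_graph G H)"
    using assms by (simp add: hom_graph_def verts_homB_graph)
  then have "(\<phi>, \<psi>) \<in> arcs (homB_graph G H p BG WG BH WH)"
    using assms(1,2) by (simp add: arcs_homB_graph)
  moreover have "tail (homB_graph G H p BG WG BH WH) = fst" "head (homB_graph G H p BG WG BH WH) = snd"
    by (auto simp: homB_graph_def hom_ext_graph_def)
  ultimately show ?thesis unfolding arcs_ends_conv by (intro rev_image_eqI) auto
qed

theorem corollary3p8:
  fixes G :: "'a pair_pre_digraph" and H :: "'b pair_pre_digraph"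
    and p :: "'a \<rightharpoonup> 'b" and k :: nat
    and BG WG :: "'a set" and BH WH :: "'b set"
  assumes "k \<ge> 3"
    and "pair_pseudo_graph H" and "connected (with_proj H)" and "NU_graph k H"
    and "pair_pseudo_graph G"
    and "precolouring G H p"
    and "bipartite H \<Longrightarrow> bipartition H BH WH"
    and "bipartite H \<Longrightarrow> bipartite G \<Longrightarrow> bipartition G BG WG"
  shows "diameter (homB_graph G H p BG WG BH WH)
      \<le> ereal (real (2 * card (pverts H) * min (k - 2) (card (pverts H)))) \<and>
    (bipartite H \<longrightarrow>
       diameter (homB_graph G H p BG WG BH WH)
         \<le> ereal (real (card (pverts H) * min (2 * (k - 2)) (card (pverts H)))))"
proof -
  interpret G: pair_pseudo_graph G by (rule assms(5))
  interpret H: pair_pseudo_graph H by (rule assms(2))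
  let ?M = "homB_graph G H p BG WG BH WH"
  interpret M: wf_digraph ?M by (rule wf_homB_graph)
  have same: "even_conn (parcs H) x y"
    if x: "x \<in> pverts H" "y \<in> pverts H" and "bipartite H \<Longrightarrow> x \<in> BH \<longleftrightarrow> y \<in> BH" for x y
    using H.even_conn_if_not_bipartite H.even_conn_iff_same_class assms(3,7) that by blast
  \<comment> \<open>Both bounds follow from this one, because \<open>min (2 * (k - 2)) n\<close> is
    at most \<open>2 * min (k - 2) n\<close>.\<close>
  have "\<exists>q. M.awalk \<phi> q \<psi> \<and> length q \<le> card (pverts H) * min (2 * (k - 2)) (card (pverts H))"
    if \<phi>: "\<phi> \<in> verts ?M" and \<psi>: "\<psi> \<in> verts ?M" for \<phi> \<psi>
  proof (cases "\<forall>x\<in>pverts H. \<exists>y. (x, y) \<in> parcs H")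
    case True
    then obtain F where F: "nu_structure (pverts H) (parcs H) k F"
      using nu_structure_if_NU_graph[OF assms(1,2,4)] by blast
    interpret nu_structure "pverts H" "parcs H" k F by (rule F)
    let ?D = "pin_lists (parcs H) (dom p) \<phi>"
    have H_eq: "\<lparr>pverts = pverts H, parcs = parcs H\<rparr> = H" by simp
    have hom: "\<phi> \<in> graph_homs G H" "\<psi> \<in> graph_homs G H" using \<phi> \<psi> by (auto simp: verts_homB_graph)
    have in_H: "\<phi> u \<in> pverts H" "\<psi> u \<in> pverts H" if "u \<in> pverts G" for u
      using that hom by (auto simp: graph_homs_def)
    have bipG: "bipartition G BG WG" if "bipartite H"
      using that assms(8) bipartite_if_hom[OF that hom(1) G.parcs_subset] by blast
    have cls: "\<chi> u \<in> BH \<longleftrightarrow> u \<in> BG" if "bipartite H" "\<chi> \<in> verts ?M" "u \<in> pverts G" for \<chi> u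
    proof -
      have "\<chi> ` BG \<subseteq> BH" "\<chi> ` WG \<subseteq> WH" using that by (auto simp: verts_homB_graph)
      moreover have "u \<in> BG \<or> u \<in> WG" using bipG[OF that(1)] that(3) by (auto simp: bipartition_def)
      moreover have "BH \<inter> WH = {}" using assms(7)[OF that(1)] by (simp add: bipartition_def)
      ultimately show ?thesis by blast
    qed
    have \<phi>D: "\<phi> \<in> list_homs G H ?D"
      using hom by (auto simp: list_homs_def pin_lists_def)
    have \<psi>D: "\<psi> \<in> list_homs G H ?D"
    proof -
      have "even_conn (parcs H) (\<psi> u) (\<phi> u)" if "u \<in> pverts G" for u
        using that in_H cls \<phi> \<psi> by (intro same) auto
      moreover have "\<psi> u = \<phi> u" if "u \<in> dom p" for u
        using that \<phi> \<psi> by (auto simp: verts_homB_graph)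
      ultimately show ?thesis using hom by (auto simp: list_homs_def pin_lists_def)
    qed
    \<comment> \<open>Walks of list homomorphisms stay in Hom_B: even walks preserve the colour
      class, and the lists fix the precoloured vertices.\<close>
    have D_M: "\<chi> \<in> verts ?M" if \<chi>: "\<chi> \<in> list_homs G H ?D" for \<chi>
    proof -
      have iff: "\<chi> u \<in> BH \<longleftrightarrow> \<phi> u \<in> BH" if "bipartite H" "u \<in> pverts G" for u
        using H.even_conn_iff_same_class[OF assms(3) assms(7)[OF that(1)]] in_H(1)[OF that(2)]
          list_homsD(2,4)[OF \<chi> that(2)] by (auto simp: pin_lists_def)
      have "\<chi> ` BG \<subseteq> BH \<and> \<chi> ` WG \<subseteq> WH" if "bipartite H"
      proof -
        have *: "\<chi> u \<in> (if u \<in> BG then BH else WH)" if "u \<in> pverts G" for u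
          using iff[OF \<open>bipartite H\<close> that] cls[OF \<open>bipartite H\<close> \<phi> that]
            list_homsD(2)[OF \<chi> that] assms(7)[OF \<open>bipartite H\<close>]
          by (auto simp: bipartition_def)
        have "BG \<union> WG = pverts G" "BG \<inter> WG = {}"
          using bipG[OF that] by (auto simp: bipartition_def)
        then have "\<chi> u \<in> BH" if "u \<in> BG" for u using *[of u] that by auto
        moreover have "\<chi> u \<in> WH" if "u \<in> WG" for u
        proof -
          have "u \<notin> BG" "u \<in> pverts G"
            using that \<open>BG \<union> WG = pverts G\<close> \<open>BG \<inter> WG = {}\<close> by blast+
          then show ?thesis using *[of u] by simp
        qed
        ultimately show ?thesis by blast
      qed
      moreover have "p v = Some (\<chi> v)" if v: "v \<in> dom p" for v
      proof -
        have "v \<in> pverts G" using v assms(6) by (auto simp: precolouring_def)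
        then have "\<chi> v = \<phi> v" using list_homsD(4)[OF \<chi>] v by (simp add: pin_lists_def)
        then show ?thesis using \<phi> v by (simp add: verts_homB_graph)
      qed
      ultimately show ?thesis using \<chi> by (simp add: verts_homB_graph list_homs_def)
    qed
    obtain d where d: "d \<le> card (pverts H) * min (2 * (k - 2)) (card (pverts H))"
      "(\<phi>, \<psi>) \<in> hom_step G H ?D ^^ d"
      using short_pinned_walk[OF G.parcs_subset G.sym_parcs, unfolded H_eq, OF \<phi>D \<psi>D] by blast
    have "(\<chi>, \<chi>') \<in> arcs_ends ?M" if "(\<chi>, \<chi>') \<in> hom_step G H ?D" for \<chi> \<chi>'
      using that D_M by (intro arcs_ends_homB_graph) (auto simp: hom_step_def)
    then have "(\<phi>, \<psi>) \<in> arcs_ends ?M ^^ d"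
      using d(2) by (rule relpow_map[where h = "\<lambda>\<chi>. \<chi>"])
    then show ?thesis using M.relpow_awalk \<phi> d(1) by metis
  next
    \<comment> \<open>A vertex without neighbours is the only vertex of a connected graph, and then
      all homomorphisms coincide.\<close>
    case False
    then obtain x where x: "x \<in> pverts H" "\<And>y. (x, y) \<notin> parcs H" by blast
    have "y = x" if "y \<in> pverts H" for y
    proof -
      obtain n where "(x, y) \<in> parcs H ^^ n"
        by (rule H.connected_relpow[OF assms(3) x(1) \<open>y \<in> pverts H\<close>])
      then have "(x, y) \<in> (parcs H)\<^sup>*" by (rule relpow_imp_rtrancl)
      then show ?thesis using x(2) by (auto elim: converse_rtranclE)
    qed
    then have "\<phi> u = \<psi> u" for u
      using \<phi> \<psi> by (cases "u \<in> pverts G") (auto simp: verts_homB_graph graph_homs_def PiE_def extensional_def)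
    then have "\<phi> = \<psi>" by blast
    then show ?thesis using \<psi> by (intro exI[of _ "[]"]) (simp add: M.awalk_Nil_iff)
  qed
  then have "diameter ?M \<le> ereal (real (card (pverts H) * min (2 * (k - 2)) (card (pverts H))))"
    unfolding diameter_le_iff[OF wf_homB_graph] by blast
  moreover have "card (pverts H) * min (2 * (k - 2)) (card (pverts H)) \<le>
      2 * card (pverts H) * min (k - 2) (card (pverts H))"
    by (auto simp: min_def)
  then have "ereal (real (card (pverts H) * min (2 * (k - 2)) (card (pverts H)))) \<le>
      ereal (real (2 * card (pverts H) * min (k - 2) (card (pverts H))))"
    unfolding ereal_less_eq of_nat_le_iff .
  ultimately show ?thesis by (auto intro: order_trans)
qed

end
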